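(* Let $\zeta\in\mathrm{IS}$ and $X,Y\in\mathbb P_\zeta$. Then there exists a homeomorphism $F:X\to Y$ such that: (1) for all $\xi\in\mathrm{IS}$ with $\xi\subseteq\zeta$ and all $x,y\in X$: $x\restriction\xi=y\restriction\xi$ iff $F(x)\restriction\xi=F(y)\restriction\xi$; (2) if $\xi\in\mathrm{IS}$, $\xi\subseteq\zeta$ and $X\restriction\xi=Y\restriction\xi$, then $x\restriction\xi=F(x)\restriction\xi$ for all $x\in X$; (3) for each $X'\subseteq X$: $X'\in\mathbb P_\zeta$ iff $F``X'=\{F(x):x\in X'\}\in\mathbb P_\zeta$.
   Context: Fix a countable partially ordered set $I$. $\mathcal D=2^\omega$ is the Cantor space. For $\xi\subseteq I$, $\mathcal D^\xi$ is the product of $\xi$ copies of $\mathcal D$ with the product topology; its points are functions $x:\xi\to\mathcal D$. For $\xi\subseteq\eta\subseteq I$, $x\in\mathcal D^\eta$, $X\subseteq\mathcal D^\eta$: $x\restriction\xi$ is the restriction, $X\restriction\xi=\{x\restriction\xi:x\in X\}$; for $X\subseteq\mathcal D^\xi$, $X\restriction^{-1}\eta=\{y\in\mathcal D^\eta:y\restriction\xi\in X\}$. $\mathrm{IS}$ is the set of initial (downward closed) subsets of $I$. For $i\in I$: $[<i]=\{j\in I:j<i\}$, $[\le i]=\{j:j\le i\}$, $[\not\ge i]=\{j\in I:\neg(j\ge i)\}$; $X\restriction_{<i}$ means $X\restriction[<i]$, etc. For $i\in\xi\in\mathrm{IS}$, $X\subseteq\mathcal D^\xi$, $z\in X\restriction_{<i}$: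 $D_{Xz}(i)=\{x(i):x\in X,\ x\restriction_{<i}=z\}$. For $\zeta\in\mathrm{IS}$, $\mathbb P'_\zeta$ is the set of all $X\subseteq\mathcal D^\zeta$ such that: (P1) $X$ is closed and nonempty; (P2) for $i\in\zeta$ and $z\in X\restriction_{<i}$, $D_{Xz}(i)$ is a perfect subset of $\mathcal D$; (P3) for $i\in\zeta$ and open $G\subseteq\mathcal D$, the set $\{x\restriction_{<i}:x\in X,\ x(i)\in G\}$ is open in $X\restriction_{<i}$; (P4) if $\xi,\eta\in\mathrm{IS}$, $\xi\cup\eta\subseteq\zeta$, $x\in X\restriction\xi$, $y\in X\restriction\eta$ and $x\restriction(\xi\cap\eta)=y\restriction(\xi\cap\eta)$, then $x\cup y\in X\restriction(\xi\cup\eta)$. For $A\subseteq\mathcal D$ with at least two points, let $l$ be the length of the longest finite binary sequence that is an initial segment of every $a\in A$, and $\mathrm{Spl}(A,e)=\{a\in A:a(l)=e\}$ for $e\in\{0,1\}$. For $X\in\mathbb P'_\zeta$ and $i\in\zeta$: $\mathrm{Spl}(X,i,e)=\{x\in X:x(i)\in\mathrm{Spl}(D_{X,x\restriction_{<i}}(i),e)\}$. A $\zeta$-admissible function is a map $\Phi:\omega\to\zeta$ taking every value in $\zeta$ infinitely many times. For $X\in\mathbb P'_\zeta$: $X_\Phi[\Lambda]=X$ ($\Lambda$ the empty sequence), $X_\Phi[u^\frown e]=\mathrm{Spl}(X_\Phi[u],\Phi(m),e)$ for $u\in2^m$, $e\in\{0,1\}$; and $X_\Phi[a]=\bigcap_m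 X_\Phi[a\restriction m]$ for $a\in2^\omega$. $X\in\mathbb P'_\zeta$ is shrinkable if $X_\Phi[a]$ is a singleton for every $\zeta$-admissible $\Phi$ and every $a\in2^\omega$. $\mathbb P_\zeta$ is the set of shrinkable members of $\mathbb P'_\zeta$. *)

theory Defs
  imports "HOL-Analysis.Analysis"
begin

text \<open>
  The Cantor space is the type \<open>nat \<Rightarrow> bool\<close>, whose type-class topology is the product of
  the discrete topologies on \<open>bool\<close>; the digits 0 and 1 are \<open>False\<close> and \<open>True\<close>.
\<close>

type_synonym cantor = "nat \<Rightarrow> bool"

text \<open>
  The poset is the type \<open>'i\<close>. A point of the power indexed by \<open>\<xi>\<close> is a function of type
  \<open>'i \<Rightarrow> cantor\<close> that is \<open>undefined\<close> outside \<open>\<xi>\<close>, so that equality of points is equality of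
  functions on \<open>\<xi>\<close>.
\<close>

definition initial_sets :: "'i::order set set" where
  "initial_sets = {\<xi>. \<forall>i\<in>\<xi>. \<forall>j\<le>i. j \<in> \<xi>}"

definition cantor_power :: "'i set \<Rightarrow> ('i \<Rightarrow> cantor) topology" where
  "cantor_power \<xi> = product_topology (\<lambda>_. euclidean) \<xi>"

definition proj :: "('i \<Rightarrow> cantor) set \<Rightarrow> 'i set \<Rightarrow> ('i \<Rightarrow> cantor) set" where
  "proj X \<xi> = (\<lambda>x. restrict x \<xi>) ` X"

definition fiber :: "('i::order \<Rightarrow> cantor) set \<Rightarrow> ('i \<Rightarrow> cantor) \<Rightarrow> 'i \<Rightarrow> cantor set" where
  "fiber X z i = {x i |x. x \<in> X \<and> restrict x {..<i} = z}"

text \<open>The empty set counts as perfect here, but it never occurs as a fiber below.\<close>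

definition perfect :: "cantor set \<Rightarrow> bool" where
  "perfect A \<longleftrightarrow> euclidean derived_set_of A = A"

text \<open>
  In the last clause \<open>merge \<xi> \<eta> (x, y)\<close> is the union of the functions \<open>x\<close> and \<open>y\<close>.
\<close>

definition IPS' :: "'i::order set \<Rightarrow> ('i \<Rightarrow> cantor) set set" where
  "IPS' \<zeta> = {X.
     (closedin (cantor_power \<zeta>) X \<and> X \<noteq> {}) \<and>
     (\<forall>i\<in>\<zeta>. \<forall>z\<in>proj X {..<i}. perfect (fiber X z i)) \<and>
     (\<forall>i\<in>\<zeta>. \<forall>G. open G \<longrightarrow>
        openin (subtopology (cantor_power {..<i}) (proj X {..<i}))
          {restrict x {..<i} |x. x \<in> X \<and> x i \<in> G}) \<and>
     (\<forall>\<xi>\<in>initial_sets. \<forall>\<eta>\<in>initial_sets. \<xi> \<union> \<eta> \<subseteq> \<zeta> \<longrightarrow>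
        (\<forall>x\<in>proj X \<xi>. \<forall>y\<in>proj X \<eta>.
           restrict x (\<xi> \<inter> \<eta>) = restrict y (\<xi> \<inter> \<eta>) \<longrightarrow>
           merge \<xi> \<eta> (x, y) \<in> proj X (\<xi> \<union> \<eta>)))}"

text \<open>
  The stem length and the sets \<open>Spl\<close> are meaningful only for \<open>A\<close> with at least two points;
  otherwise no longest common initial segment exists and \<open>GREATEST\<close> is unspecified.
\<close>

definition stem_length :: "cantor set \<Rightarrow> nat" where
  "stem_length A = (GREATEST n. \<exists>s::bool list. length s = n \<and> (\<forall>a\<in>A. map a [0..<n] = s))"

definition Spl :: "cantor set \<Rightarrow> bool \<Rightarrow> cantor set" where
  "Spl A e = {a\<in>A. a (stem_length A) = e}"

definition Spl_at :: "('i::order \<Rightarrow> cantor) set \<Rightarrow> 'i \<Rightarrow> bool \<Rightarrow> ('i \<Rightarrow> cantor) set" where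
  "Spl_at X i e = {x\<in>X. x i \<in> Spl (fiber X (restrict x {..<i}) i) e}"

definition admissible :: "'i set \<Rightarrow> (nat \<Rightarrow> 'i) \<Rightarrow> bool" where
  "admissible \<zeta> \<Phi> \<longleftrightarrow> range \<Phi> \<subseteq> \<zeta> \<and> (\<forall>i\<in>\<zeta>. infinite {m. \<Phi> m = i})"

definition split_fin ::
  "('i::order \<Rightarrow> cantor) set \<Rightarrow> (nat \<Rightarrow> 'i) \<Rightarrow> bool list \<Rightarrow> ('i \<Rightarrow> cantor) set" where
  "split_fin X \<Phi> u = foldl (\<lambda>Z (m, e). Spl_at Z (\<Phi> m) e) X (List.enumerate 0 u)"

lemma split_fin_Nil: "split_fin X \<Phi> [] = X"
  by (simp add: split_fin_def)

lemma split_fin_snoc: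
  "split_fin X \<Phi> (u @ [e]) = Spl_at (split_fin X \<Phi> u) (\<Phi> (length u)) e"
  by (simp add: split_fin_def enumerate_append_eq)

definition split_inf ::
  "('i::order \<Rightarrow> cantor) set \<Rightarrow> (nat \<Rightarrow> 'i) \<Rightarrow> cantor \<Rightarrow> ('i \<Rightarrow> cantor) set" where
  "split_inf X \<Phi> a = (\<Inter>m. split_fin X \<Phi> (map a [0..<m]))"

definition shrinkable :: "'i::order set \<Rightarrow> ('i \<Rightarrow> cantor) set \<Rightarrow> bool" where
  "shrinkable \<zeta> X \<longleftrightarrow> (\<forall>\<Phi>. admissible \<zeta> \<Phi> \<longrightarrow> (\<forall>a. is_singleton (split_inf X \<Phi> a)))"

definition IPS :: "'i::order set \<Rightarrow> ('i \<Rightarrow> cantor) set set" where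
  "IPS \<zeta> = {X \<in> IPS' \<zeta>. shrinkable \<zeta> X}"

end

theory Submission
  imports Defs
begin

text \<open>
  Fix an admissible \<open>\<Phi>\<close>. Since \<open>X\<close> is shrinkable, its iterated splittings along \<open>\<Phi>\<close> put the
  points of \<open>X\<close> in a homeomorphic correspondence with their codes in \<open>2\<^sup>\<omega>\<close>, and \<open>F\<close> sends a
  point of \<open>X\<close> to the point of \<open>Y\<close> with the same code. The projection of a splitting of \<open>X\<close> at
  \<open>i\<close> to an initial set \<open>\<xi>\<close> is that of \<open>X\<close> if \<open>i \<notin> \<xi>\<close>, and depends only on the projection of
  \<open>X\<close> if \<open>i \<in> \<xi>\<close>; by compactness, the restriction of a point to \<open>\<xi>\<close> is therefore determined by,
  and determines, the values of its code at the \<open>m\<close> with \<open>\<Phi> m \<in> \<xi>\<close>, and it is the same for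
  \<open>X\<close> and \<open>Y\<close> if their projections agree. This gives (1) and (2). For (3), the closure properties
  are invariant under homeomorphisms satisfying (1), and whether a point belongs to
  \<open>Spl\<close> of a subset with code \<open>S\<close> can be read off its code and \<open>S\<close>: the fiber through the point
  first splits at the least \<open>k\<close> with \<open>\<Phi> k = i\<close> at which two codes in \<open>S\<close>, equal below
  \<open>i\<close>, differ, and the side of the split is the digit at \<open>k\<close>. Hence \<open>F\<close> commutes with all
  splittings of \<open>X'\<close> and preserves shrinkability.
\<close>

subsection \<open>Topology of the powers of the Cantor space\<close>

text \<open>
  The library makes a function space Hausdorff only through its instance for countable products
  of metric spaces, so \<open>bool\<close> has to be a metric space before points of the power can be separated.
\<close>

instantiation bool :: metric_space
begin

definition dist_bool_def: "dist (x::bool) y = of_bool (x \<noteq> y)"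

definition uniformity_bool_def:
  "(uniformity :: (bool \<times> bool) filter) = (INF e\<in>{0 <..}. principal {(x, y). dist x y < e})"

instance
proof
  show "open U \<longleftrightarrow> (\<forall>x\<in>U. \<forall>\<^sub>F (x', y) in uniformity. x' = x \<longrightarrow> y \<in> U)" for U :: "bool set"
  proof -
    have "\<forall>\<^sub>F (x', y) in uniformity. x' = (y::bool)"
      unfolding uniformity_bool_def
      by (rule eventually_INF1[of 1]) (auto simp: eventually_principal dist_bool_def)
    then have "\<forall>\<^sub>F (x', y) in uniformity. x' = x \<longrightarrow> y \<in> U" if "x \<in> U" for x
      by (rule eventually_mono) (use that in auto)
    then show ?thesis by (auto simp: open_discrete)
  qed
qed (auto simp: dist_bool_def uniformity_bool_def of_bool_def)

end

lemma compact_UNIV_fun: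
  assumes "compact (UNIV :: 'b::topological_space set)"
  shows "compact (UNIV :: ('a \<Rightarrow> 'b) set)"
proof -
  have "compact_space (product_topology (\<lambda>_::'a. euclidean :: 'b topology) UNIV)"
    using assms unfolding compact_space_product_topology by (simp add: compact_space_def)
  then show ?thesis
    by (simp add: euclidean_product_topology compact_space_def)
qed

lemma compact_UNIV_cantor: "compact (UNIV :: cantor set)"
  by (intro compact_UNIV_fun finite_imp_compact finite)

lemma compact_UNIV_power: "compact (UNIV :: ('i::countable \<Rightarrow> cantor) set)"
  by (intro compact_UNIV_fun compact_UNIV_cantor)

lemma continuous_on_eval: "continuous_on S (\<lambda>x. x i)"
  by (rule continuous_on_subset[OF continuous_on_product_coordinates]) simp

lemma continuous_on_restrict: "continuous_on S (\<lambda>x. restrict x \<xi> :: 'i::countable \<Rightarrow> cantor)"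
proof (rule continuous_on_coordinatewise_then_product)
  fix i
  show "continuous_on S (\<lambda>x. restrict x \<xi> i :: cantor)"
    by (cases "i \<in> \<xi>") (simp_all add: continuous_on_eval)
qed

lemma closed_PiE_UNIV: "closed (PiE \<zeta> (\<lambda>_. UNIV) :: ('i::countable \<Rightarrow> cantor) set)"
proof -
  have "PiE \<zeta> (\<lambda>_. UNIV) = (\<Inter>i\<in>-\<zeta>. {x::'i \<Rightarrow> cantor. x i = undefined})"
    by (auto simp: PiE_def extensional_def)
  moreover have "closed {x::'i \<Rightarrow> cantor. x i = undefined}" for i
    by (intro closed_Collect_eq continuous_on_eval continuous_on_const)
  ultimately show ?thesis by (auto intro!: closed_INT)
qed

text \<open>Outside \<open>\<zeta>\<close> all points are constantly \<open>undefined\<close>, so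
  the identity is continuous in both directions. Closedness and compactness in the type-class
  topology thereby become available for the powers.\<close>

lemma cantor_power_eq: "cantor_power (\<zeta> :: 'i::countable set) = top_of_set (PiE \<zeta> (\<lambda>_. UNIV))"
proof -
  let ?P = "PiE \<zeta> (\<lambda>_. UNIV) :: ('i \<Rightarrow> cantor) set"
  have 1: "continuous_map (cantor_power \<zeta>) (top_of_set ?P) id"
  proof -
    have "continuous_map (cantor_power \<zeta>) (product_topology (\<lambda>_. euclidean) UNIV) (id :: _ \<Rightarrow> 'i \<Rightarrow> cantor)"
    proof (subst continuous_map_componentwise_UNIV, rule allI)
      fix k
      show "continuous_map (cantor_power \<zeta>) euclidean (\<lambda>x. (id x :: 'i \<Rightarrow> cantor) k)"
      proof (cases "k \<in> \<zeta>")
        case True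
        then show ?thesis
          using continuous_map_product_projection[of k \<zeta> "\<lambda>_. euclidean :: cantor topology"]
          by (simp add: cantor_power_def)
      next
        case False
        have "continuous_map (cantor_power \<zeta>) euclidean (\<lambda>x. undefined :: cantor)"
          by simp
        then show ?thesis
          by (rule continuous_map_eq) (use False in \<open>auto simp: cantor_power_def PiE_def extensional_def\<close>)
      qed
    qed
    then show ?thesis
      by (auto simp: euclidean_product_topology continuous_map_in_subtopology cantor_power_def PiE_iff)
  qed
  have 2: "continuous_map (top_of_set ?P) (cantor_power \<zeta>) id"
    by (auto simp: cantor_power_def continuous_map_componentwise PiE_iff continuous_on_eval)
  have "openin (cantor_power \<zeta>) U \<longleftrightarrow> openin (top_of_set ?P) U" for U
  proof
    assume U: "openin (cantor_power \<zeta>) U"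
    then have "openin (top_of_set ?P) {x \<in> ?P. id x \<in> U}"
      using openin_continuous_map_preimage[OF 2 U] by simp
    moreover have "{x \<in> ?P. id x \<in> U} = U"
      using openin_subset[OF U] by (auto simp: cantor_power_def)
    ultimately show "openin (top_of_set ?P) U" by simp
  next
    assume U: "openin (top_of_set ?P) U"
    then have "openin (cantor_power \<zeta>) {x \<in> ?P. id x \<in> U}"
      using openin_continuous_map_preimage[OF 1 U] by (simp add: cantor_power_def)
    moreover have "{x \<in> ?P. id x \<in> U} = U"
      using openin_subset[OF U] by auto
    ultimately show "openin (cantor_power \<zeta>) U" by simp
  qed
  then show ?thesis by (simp add: topology_eq)
qed

lemma subtopology_cantor_power:
  fixes X :: "('i::countable \<Rightarrow> cantor) set"
  shows "X \<subseteq> PiE \<zeta> (\<lambda>_. UNIV) \<Longrightarrow> subtopology (cantor_power \<zeta>) X = top_of_set X"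
  by (simp add: cantor_power_eq subtopology_subtopology Int_absorb1)

lemma closedin_cantor_power:
  fixes X :: "('i::countable \<Rightarrow> cantor) set"
  shows "closedin (cantor_power \<zeta>) X \<longleftrightarrow> X \<subseteq> PiE \<zeta> (\<lambda>_. UNIV) \<and> closed X"
  by (auto simp: cantor_power_eq closedin_closed_eq[OF closed_PiE_UNIV])

lemma compact_iff_closed_power: "compact (K :: ('i::countable \<Rightarrow> cantor) set) \<longleftrightarrow> closed K"
  using compact_Int_closed[OF compact_UNIV_power, of K] compact_imp_closed by auto

text \<open>A point \<open>a\<close> of a closed \<open>A\<close> is isolated exactly when
  \<open>A - {a}\<close> is closed. Phrased with closed sets only, perfectness can be carried along
  continuous maps on compact sets.\<close>

lemma perfect_iff: "perfect A \<longleftrightarrow> closed A \<and> (\<forall>a\<in>A. \<not> closed (A - {a}))"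
proof
  assume A: "perfect A"
  have "closedin euclidean (euclidean derived_set_of A)"
    by (intro closedin_derived_set_of) (simp add: Hausdorff_space_euclidean)
  then have "closed A"
    using A by (simp add: perfect_def)
  moreover have "\<not> closed (A - {a})" if a: "a \<in> A" for a
  proof
    assume "closed (A - {a})"
    then have "open (- (A - {a}))" by (rule open_Compl)
    moreover have "a \<in> euclidean derived_set_of A"
      using A a by (simp add: perfect_def)
    ultimately show False
      unfolding in_derived_set_of by (metis ComplD ComplI Diff_iff insertCI open_openin singletonD)
  qed
  ultimately show "closed A \<and> (\<forall>a\<in>A. \<not> closed (A - {a}))" by blast
next
  assume A: "closed A \<and> (\<forall>a\<in>A. \<not> closed (A - {a}))"
  have "a \<in> euclidean derived_set_of A" if a: "a \<in> A" for a
  proof -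
    have "\<exists>y. y \<noteq> a \<and> y \<in> A \<and> y \<in> T" if T: "a \<in> T" "open T" for T
    proof (rule ccontr)
      assume "\<not> ?thesis"
      then have "A - {a} = A - T" using T by blast
      then show False using A a T by (metis closed_Diff)
    qed
    then show ?thesis by (simp add: in_derived_set_of)
  qed
  moreover have "euclidean derived_set_of A \<subseteq> A"
    using A closedin_contains_derived_set[of euclidean A] by simp
  ultimately show "perfect A" by (auto simp: perfect_def)
qed

lemma perfect_Int_clopen:
  assumes "perfect A" "closed C" "open C"
  shows "perfect (A \<inter> C)"
proof -
  have "\<not> closed (A \<inter> C - {a})" if "a \<in> A \<inter> C" for a
  proof
    assume "closed (A \<inter> C - {a})"
    then have "closed ((A \<inter> C - {a}) \<union> (A - C))"
      using assms by (intro closed_Un) (auto simp: perfect_iff)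
    moreover have "(A \<inter> C - {a}) \<union> (A - C) = A - {a}"
      using that by blast
    ultimately show False using assms that by (auto simp: perfect_iff)
  qed
  then show ?thesis using assms by (auto simp: perfect_iff)
qed

section \<open>The defining clauses restated for points of the set itself\<close>

lemma restrict_eq_iff: "restrict x \<xi> = restrict y \<xi> \<longleftrightarrow> (\<forall>i\<in>\<xi>. x i = y i)"
  by (auto simp: restrict_def fun_eq_iff)

lemma mem_fiber:
  "c \<in> fiber X (restrict x {..<i}) i \<longleftrightarrow> (\<exists>y\<in>X. (\<forall>j<i. y j = x j) \<and> y i = c)"
  by (auto simp: fiber_def restrict_eq_iff)

lemma lessThan_initial: "{..<i} \<in> initial_sets"
  by (auto simp: initial_sets_def intro: le_less_trans)

lemma atMost_initial: "{..i} \<in> initial_sets"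
  by (auto simp: initial_sets_def intro: order_trans)

lemma initial_setsD: "\<xi> \<in> initial_sets \<Longrightarrow> i \<in> \<xi> \<Longrightarrow> j \<le> i \<Longrightarrow> j \<in> \<xi>"
  by (auto simp: initial_sets_def)

lemma lessThan_subset: "\<zeta> \<in> initial_sets \<Longrightarrow> i \<in> \<zeta> \<Longrightarrow> {..<i} \<subseteq> \<zeta>"
  by (auto simp: initial_sets_def)

lemma atMost_subset: "\<xi> \<in> initial_sets \<Longrightarrow> i \<in> \<xi> \<Longrightarrow> {..i} \<subseteq> \<xi>"
  by (auto simp: initial_sets_def)

text \<open>For \<open>V\<close> inside \<open>X\<close> this is the preimage in \<open>X\<close> of
  the projection of \<open>V\<close> to \<open>{..<i}\<close>.\<close>

definition lift_set :: "('i::order \<Rightarrow> cantor) set \<Rightarrow> 'i \<Rightarrow> ('i \<Rightarrow> cantor) set \<Rightarrow> ('i \<Rightarrow> cantor) set" where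
  "lift_set X i V = {x\<in>X. \<exists>y\<in>V. \<forall>j<i. x j = y j}"

text \<open>The amalgamation clause of \<open>IPS'\<close>, with points of projections replaced by
  representatives in \<open>X\<close>.\<close>

definition glueing :: "'i::order set \<Rightarrow> ('i \<Rightarrow> cantor) set \<Rightarrow> bool" where
  "glueing \<zeta> X \<longleftrightarrow> (\<forall>\<xi>\<in>initial_sets. \<forall>\<eta>\<in>initial_sets. \<xi> \<union> \<eta> \<subseteq> \<zeta> \<longrightarrow>
     (\<forall>x\<in>X. \<forall>y\<in>X. (\<forall>i\<in>\<xi> \<inter> \<eta>. x i = y i) \<longrightarrow>
        (\<exists>w\<in>X. (\<forall>i\<in>\<xi>. w i = x i) \<and> (\<forall>i\<in>\<eta>. w i = y i))))"

text \<open>A closed set in the power is compact, so the projection of \<open>K\<close> is compact,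
  and the lift is its preimage.\<close>

lemma closed_lift_set:
  fixes X :: "('i::{order,countable} \<Rightarrow> cantor) set"
  assumes "closed X" "closed K"
  shows "closed (lift_set X i K)"
proof -
  have "compact ((\<lambda>x. restrict x {..<i}) ` K)"
    using assms by (intro compact_continuous_image continuous_on_restrict) (simp add: compact_iff_closed_power)
  then have "closed (X \<inter> (\<lambda>x. restrict x {..<i}) -` ((\<lambda>x. restrict x {..<i}) ` K))"
    using assms by (intro continuous_closed_preimage continuous_on_restrict) (auto simp: compact_imp_closed)
  also have "X \<inter> (\<lambda>x. restrict x {..<i}) -` ((\<lambda>x. restrict x {..<i}) ` K) = lift_set X i K"
    by (auto simp: lift_set_def restrict_eq_iff image_iff)
  finally show ?thesis .
qed

text \<open>Restriction is a quotient map from the compact \<open>X\<close> onto its projection, and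
  the lift is the preimage of the projection of \<open>V\<close>.\<close>

lemma openin_proj_iff:
  fixes X :: "('i::{order,countable} \<Rightarrow> cantor) set"
  assumes "closed X" "V \<subseteq> X"
  shows "openin (top_of_set (proj X {..<i})) (proj V {..<i}) \<longleftrightarrow> openin (top_of_set X) (lift_set X i V)"
proof -
  let ?r = "\<lambda>x::'i \<Rightarrow> cantor. restrict x {..<i}"
  have *: "X \<inter> ?r -` (?r ` V) = lift_set X i V"
    by (auto simp: lift_set_def restrict_eq_iff image_iff)
  have "openin (top_of_set X) (X \<inter> ?r -` (?r ` V)) \<longleftrightarrow> openin (top_of_set (?r ` X)) (?r ` V)"
  proof (rule Abstract_Topology_2.continuous_imp_quotient_map[OF continuous_on_restrict refl])
    show "compact X" using assms by (simp add: compact_iff_closed_power)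
    show "?r ` V \<subseteq> ?r ` X" using assms by blast
  qed
  then show ?thesis unfolding * proj_def by (rule sym)
qed

text \<open>
  The openness clause is pulled back from the projection to \<open>X\<close> itself, along a map that is
  a quotient map by compactness. In this form it is visibly transported by homeomorphisms.
\<close>

lemma IPS'_iff:
  fixes X :: "('i::{order,countable} \<Rightarrow> cantor) set"
  assumes \<zeta>: "\<zeta> \<in> initial_sets"
  shows "X \<in> IPS' \<zeta> \<longleftrightarrow> X \<subseteq> PiE \<zeta> (\<lambda>_. UNIV) \<and> closed X \<and> X \<noteq> {} \<and>
     (\<forall>i\<in>\<zeta>. \<forall>x\<in>X. perfect (fiber X (restrict x {..<i}) i)) \<and>
     (\<forall>i\<in>\<zeta>. \<forall>G. open G \<longrightarrow> openin (top_of_set X) (lift_set X i {x\<in>X. x i \<in> G})) \<and>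
     glueing \<zeta> X"
proof (cases "X \<subseteq> PiE \<zeta> (\<lambda>_. UNIV) \<and> closed X")
  case True
  have P3: "openin (subtopology (cantor_power {..<i}) (proj X {..<i})) {restrict x {..<i} |x. x \<in> X \<and> x i \<in> G}
      \<longleftrightarrow> openin (top_of_set X) (lift_set X i {x\<in>X. x i \<in> G})" for i G
  proof -
    have "{restrict x {..<i} |x. x \<in> X \<and> x i \<in> G} = proj {x\<in>X. x i \<in> G} {..<i}"
      by (auto simp: proj_def)
    moreover have "subtopology (cantor_power {..<i}) (proj X {..<i}) = top_of_set (proj X {..<i})"
      by (rule subtopology_cantor_power) (auto simp: proj_def)
    ultimately show ?thesis
      using True by (simp add: openin_proj_iff)
  qed
  have P2: "(\<forall>z\<in>proj X {..<i}. perfect (fiber X z i)) \<longleftrightarrow> (\<forall>x\<in>X. perfect (fiber X (restrict x {..<i}) i))" for i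
    by (simp add: proj_def)
  have P4: "(\<forall>x\<in>proj X \<xi>. \<forall>y\<in>proj X \<eta>.
           restrict x (\<xi> \<inter> \<eta>) = restrict y (\<xi> \<inter> \<eta>) \<longrightarrow>
           merge \<xi> \<eta> (x, y) \<in> proj X (\<xi> \<union> \<eta>)) \<longleftrightarrow>
       (\<forall>x\<in>X. \<forall>y\<in>X. (\<forall>i\<in>\<xi> \<inter> \<eta>. x i = y i) \<longrightarrow>
        (\<exists>w\<in>X. (\<forall>i\<in>\<xi>. w i = x i) \<and> (\<forall>i\<in>\<eta>. w i = y i)))" (is "?L \<longleftrightarrow> ?R") for \<xi> \<eta>
  proof -
    \<comment> \<open>On the overlap \<open>merge\<close> takes the value of its first argument;
      there \<open>eq\<close> yields agreement with \<open>y\<close> as well.\<close>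
    have "merge \<xi> \<eta> (restrict x \<xi>, restrict y \<eta>) \<in> proj X (\<xi> \<union> \<eta>) \<longleftrightarrow>
        (\<exists>w\<in>X. (\<forall>i\<in>\<xi>. w i = x i) \<and> (\<forall>i\<in>\<eta>. w i = y i))" (is "?A \<longleftrightarrow> ?B")
      if eq: "\<forall>i\<in>\<xi> \<inter> \<eta>. x i = y i" for x y
    proof -
      have "merge \<xi> \<eta> (restrict x \<xi>, restrict y \<eta>) = restrict w (\<xi> \<union> \<eta>) \<longleftrightarrow>
        (\<forall>i\<in>\<xi>. w i = x i) \<and> (\<forall>i\<in>\<eta>. w i = y i)" for w
        using eq by (auto simp: fun_eq_iff merge_def restrict_def)
      then show ?thesis by (auto simp: proj_def image_iff)
    qed
    moreover have "restrict (restrict x \<xi>) (\<xi> \<inter> \<eta>) = restrict (restrict y \<eta>) (\<xi> \<inter> \<eta>) \<longleftrightarrow> (\<forall>i\<in>\<xi> \<inter> \<eta>. x i = y i)" for x y :: "'i \<Rightarrow> cantor"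
      unfolding restrict_eq_iff by auto
    ultimately show ?thesis
      unfolding proj_def ball_simps by simp
  qed
  show ?thesis
    unfolding IPS'_def mem_Collect_eq closedin_cantor_power P2 P3 P4 glueing_def
    using True by (simp only: simp_thms)
qed (auto simp: IPS'_def closedin_cantor_power)

subsection \<open>Images under maps respecting initial sets\<close>

text \<open>The fiber is the image, under evaluation at \<open>i\<close>, of a compact set of
  points.\<close>

lemma closed_fiber:
  fixes X :: "('i::{order,countable} \<Rightarrow> cantor) set"
  assumes "closed X"
  shows "closed (fiber X (restrict x {..<i}) i)"
proof -
  have eq: "{y. \<forall>j<i. y j = x j} = (\<Inter>j\<in>{..<i}. {y. y j = x j})"
    by auto
  have "closed {y::'i \<Rightarrow> cantor. \<forall>j<i. y j = x j}"
    unfolding eq by (intro closed_INT ballI closed_Collect_eq continuous_on_eval continuous_on_const)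
  then have "compact (X \<inter> {y. \<forall>j<i. y j = x j})"
    using assms by (auto simp: compact_iff_closed_power)
  then have "closed ((\<lambda>y. y i) ` (X \<inter> {y. \<forall>j<i. y j = x j}))"
    by (intro compact_imp_closed compact_continuous_image continuous_on_eval)
  also have "(\<lambda>y. y i) ` (X \<inter> {y. \<forall>j<i. y j = x j}) = fiber X (restrict x {..<i}) i"
    by (auto simp: fiber_def restrict_eq_iff)
  finally show ?thesis .
qed

lemma glueingD:
  assumes "glueing \<zeta> X" "\<xi> \<in> initial_sets" "\<eta> \<in> initial_sets" "\<xi> \<union> \<eta> \<subseteq> \<zeta>"
    and "x \<in> X" "y \<in> X" "\<forall>i\<in>\<xi> \<inter> \<eta>. x i = y i"
  shows "\<exists>w\<in>X. (\<forall>i\<in>\<xi>. w i = x i) \<and> (\<forall>i\<in>\<eta>. w i = y i)"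
  using assms unfolding glueing_def by blast

text \<open>Extends the openness clause from conditions on the value at \<open>i\<close> to open
  sets depending on all coordinates up to \<open>i\<close>. Locally such a set contains a box, one
  side constraining the coordinates below \<open>i\<close> and the other the value at
  \<open>i\<close>, and the clause handles the second side.\<close>

lemma openin_lift_set_saturated:
  fixes X :: "('i::{order,countable} \<Rightarrow> cantor) set"
  assumes "\<zeta> \<in> initial_sets" "X \<in> IPS' \<zeta>" "i \<in> \<zeta>"
    and V: "openin (top_of_set X) V"
    and sat: "\<And>x y. x \<in> V \<Longrightarrow> y \<in> X \<Longrightarrow> \<forall>j\<le>i. x j = y j \<Longrightarrow> y \<in> V"
  shows "openin (top_of_set X) (lift_set X i V)"
proof (subst openin_subopen, intro ballI)
  have X: "closed X" "openin (top_of_set X) (lift_set X i {x\<in>X. x i \<in> G})" if "open G" for G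
    using assms that by (auto simp: IPS'_iff)
  have "V \<subseteq> X" using V by (rule openin_imp_subset)
  let ?r = "\<lambda>x::'i \<Rightarrow> cantor. restrict x {..i}"
  \<comment> \<open>By saturation \<open>V\<close> is the full preimage of its image, so the
    quotient map makes that image open.\<close>
  have "X \<inter> ?r -` (?r ` V) = V"
    using \<open>V \<subseteq> X\<close> sat by (fastforce simp: restrict_eq_iff)
  moreover have "openin (top_of_set X) (X \<inter> ?r -` (?r ` V)) \<longleftrightarrow> openin (top_of_set (?r ` X)) (?r ` V)"
  proof (rule Abstract_Topology_2.continuous_imp_quotient_map[OF continuous_on_restrict refl])
    show "compact X" using X[of "{}"] by (simp add: compact_iff_closed_power)
    show "?r ` V \<subseteq> ?r ` X" using \<open>V \<subseteq> X\<close> by blast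
  qed
  ultimately have "openin (top_of_set (?r ` X)) (?r ` V)" using V by simp
  then obtain P where P: "open P" "?r ` V = ?r ` X \<inter> P"
    by (auto simp: openin_open)
  \<comment> \<open>\<open>g\<close> joins the part of a point below \<open>i\<close> to a new value
    at \<open>i\<close>; the default \<open>undefined\<close> elsewhere makes the result a
    restriction to \<open>{..i}\<close>.\<close>
  define g :: "('i \<Rightarrow> cantor) \<times> cantor \<Rightarrow> 'i \<Rightarrow> cantor"
    where "g = (\<lambda>p j. if j < i then fst p j else if j = i then snd p else undefined)"
  have "continuous_on UNIV g"
  proof (rule continuous_on_coordinatewise_then_product)
    fix j
    have "continuous_on UNIV (\<lambda>p::('i \<Rightarrow> cantor) \<times> cantor. fst p j)"
      by (rule continuous_on_product_then_coordinatewise) (intro continuous_intros)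
    then show "continuous_on UNIV (\<lambda>p. g p j)"
      unfolding g_def by (cases "j < i"; cases "j = i") (simp_all add: continuous_on_snd continuous_on_const)
  qed
  then have gP: "open (g -` P)"
    using P(1) by (simp add: continuous_on_open_vimage)
  have g: "g (w, y i) = ?r y" if "\<forall>j<i. w j = y j" for w y
    using that by (auto simp: g_def fun_eq_iff le_less)
  fix x assume "x \<in> lift_set X i V"
  then obtain x' where x': "x \<in> X" "x' \<in> V" "\<forall>j<i. x j = x' j"
    by (auto simp: lift_set_def)
  then have "(x, x' i) \<in> g -` P"
    using g P(2) by auto
  then obtain Q G where QG: "open Q" "open G" "(x, x' i) \<in> Q \<times> G" "Q \<times> G \<subseteq> g -` P"
    using open_prod_elim[OF gP] by blast
  \<comment> \<open>For \<open>w\<close> in \<open>?T\<close> the lift provides \<open>y\<close>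
    equal to \<open>w\<close> below \<open>i\<close> with value at \<open>i\<close> in
    \<open>G\<close>. The box puts the restriction of \<open>y\<close> into \<open>P\<close>, and
    saturation puts \<open>y\<close> into \<open>V\<close>.\<close>
  let ?T = "(X \<inter> Q) \<inter> lift_set X i {y\<in>X. y i \<in> G}"
  have "?T \<subseteq> lift_set X i V"
  proof
    fix w assume w: "w \<in> ?T"
    then obtain y where y: "y \<in> X" "y i \<in> G" "\<forall>j<i. w j = y j"
      by (auto simp: lift_set_def)
    then have "?r y \<in> P"
      using g[OF y(3)] QG(4) w by auto
    then have "?r y \<in> ?r ` V"
      using P(2) y(1) by blast
    then obtain v where v: "v \<in> V" "?r y = ?r v" by blast
    then have "y \<in> V"
      using sat[OF v(1) y(1)] unfolding restrict_eq_iff by auto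
    then show "w \<in> lift_set X i V"
      using w y by (auto simp: lift_set_def)
  qed
  moreover have "openin (top_of_set X) ?T"
    using X(2)[OF QG(2)] openin_open_Int[OF QG(1)] by (rule openin_Int[rotated])
  moreover have "x \<in> ?T"
    using x' QG(3) \<open>V \<subseteq> X\<close> by (auto simp: lift_set_def)
  ultimately show "\<exists>T. openin (top_of_set X) T \<and> x \<in> T \<and> T \<subseteq> lift_set X i V"
    by blast
qed

text \<open>Applied to \<open>{..<i}\<close> and \<open>{..i}\<close>, \<open>resp\<close> makes
  \<open>F\<close> map fibers injectively onto fibers, and compactness makes \<open>F\<close> a
  quotient map onto its image.\<close>

lemma IPS'_image:
  fixes X :: "('i::{order,countable} \<Rightarrow> cantor) set"
  assumes \<zeta>: "\<zeta> \<in> initial_sets" and X: "X \<in> IPS' \<zeta>"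
    and cont: "continuous_on X F" and ext: "F ` X \<subseteq> PiE \<zeta> (\<lambda>_. UNIV)"
    and resp: "\<And>\<xi> x y. \<xi> \<in> initial_sets \<Longrightarrow> \<xi> \<subseteq> \<zeta> \<Longrightarrow> x \<in> X \<Longrightarrow> y \<in> X \<Longrightarrow>
      (\<forall>i\<in>\<xi>. F x i = F y i) \<longleftrightarrow> (\<forall>i\<in>\<xi>. x i = y i)"
  shows "F ` X \<in> IPS' \<zeta>"
  unfolding IPS'_iff[OF \<zeta>]
proof (intro conjI ballI allI impI)
  have clX: "closed X" and compX: "compact X" and neX: "X \<noteq> {}"
    using X by (auto simp: IPS'_iff[OF \<zeta>] compact_iff_closed_power)
  have resp_lt: "(\<forall>j<i. F x j = F y j) \<longleftrightarrow> (\<forall>j<i. x j = y j)"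
    if "i \<in> \<zeta>" "x \<in> X" "y \<in> X" for i x y
    using resp[OF lessThan_initial[of i] lessThan_subset[OF \<zeta>]] that by auto
  have resp_le: "(\<forall>j\<le>i. F x j = F y j) \<longleftrightarrow> (\<forall>j\<le>i. x j = y j)"
    if "i \<in> \<zeta>" "x \<in> X" "y \<in> X" for i x y
    using resp[OF atMost_initial[of i] atMost_subset[OF \<zeta>]] that by auto
  have resp_at: "F x i = F y i \<longleftrightarrow> x i = y i"
    if "i \<in> \<zeta>" "x \<in> X" "y \<in> X" "\<forall>j<i. x j = y j" for i x y
  proof -
    have "(\<forall>j<i. F x j = F y j)" using that resp_lt by blast
    then show ?thesis
      using resp_le[OF that(1-3)] that(4) by (auto simp: le_less)
  qed
  have contF: "continuous_on X (\<lambda>x. F x i)" for i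
    using cont by (rule continuous_on_product_then_coordinatewise)
  show "F ` X \<subseteq> PiE \<zeta> (\<lambda>_. UNIV)" by (rule ext)
  show clFX: "closed (F ` X)"
    using cont compX by (intro compact_imp_closed compact_continuous_image)
  show "F ` X \<noteq> {}" using neX by simp
  show "perfect (fiber (F ` X) (restrict y {..<i}) i)" if i: "i \<in> \<zeta>" and y: "y \<in> F ` X" for i y
  proof -
    obtain x where x: "x \<in> X" "y = F x" using y by blast
    let ?A = "fiber X (restrict x {..<i}) i" and ?B = "fiber (F ` X) (restrict y {..<i}) i"
    have A: "perfect ?A"
      using X x i by (auto simp: IPS'_iff[OF \<zeta>])
    have "\<not> closed (?B - {b})" if b: "b \<in> ?B" for b
    proof
      assume cl: "closed (?B - {b})"
      obtain w where w: "w \<in> X" "\<forall>j<i. F w j = F x j" "b = F w i"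
        using b x by (auto simp: mem_fiber)
      then have w_lt: "\<forall>j<i. w j = x j" using resp_lt i x by blast
      \<comment> \<open>The points with value of \<open>F\<close> in \<open>?B - {b}\<close> form a
        closed set. Its fiber through \<open>x\<close> is \<open>?A - {w i}\<close>, which would
        isolate \<open>w i\<close> in the perfect set \<open>?A\<close>.\<close>
      have "closed (fiber (X \<inter> (\<lambda>u. F u i) -` (?B - {b})) (restrict x {..<i}) i)"
        by (intro closed_fiber continuous_closed_preimage contF clX cl)
      also have "fiber (X \<inter> (\<lambda>u. F u i) -` (?B - {b})) (restrict x {..<i}) i = ?A - {w i}"
      proof (intro set_eqI iffI)
        fix c assume "c \<in> fiber (X \<inter> (\<lambda>u. F u i) -` (?B - {b})) (restrict x {..<i}) i"
        then obtain u where u: "u \<in> X" "F u i \<noteq> F w i" "\<forall>j<i. u j = x j" "u i = c"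
          using w by (auto simp: mem_fiber)
        then have "c \<noteq> w i" using resp_at[OF i u(1) w(1)] w_lt by auto
        then show "c \<in> ?A - {w i}" using u by (auto simp: mem_fiber)
      next
        fix c assume "c \<in> ?A - {w i}"
        then obtain u where u: "u \<in> X" "u i \<noteq> w i" "\<forall>j<i. u j = x j" "u i = c"
          by (auto simp: mem_fiber)
        then have "F u i \<noteq> F w i" using resp_at[OF i u(1) w(1)] w_lt by auto
        moreover have "\<forall>j<i. F u j = F x j" using resp_lt[OF i u(1) x(1)] u by blast
        moreover from this have "F u i \<in> ?B"
          using u x by (auto simp: mem_fiber)
        ultimately have "u \<in> X \<inter> (\<lambda>u. F u i) -` (?B - {b})"
          using u(1) w(3) by simp
        then show "c \<in> fiber (X \<inter> (\<lambda>u. F u i) -` (?B - {b})) (restrict x {..<i}) i"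
          using u(3,4) by (subst mem_fiber) blast
      qed
      finally have "closed (?A - {w i})" .
      moreover have "w i \<in> ?A" using w w_lt by (auto simp: mem_fiber)
      ultimately show False using A by (auto simp: perfect_iff)
    qed
    then show ?thesis
      using closed_fiber[OF clFX] by (auto simp: perfect_iff)
  qed
  show "openin (top_of_set (F ` X)) (lift_set (F ` X) i {x\<in>F ` X. x i \<in> G})"
    if i: "i \<in> \<zeta>" and G: "open G" for i G
  proof -
    let ?L = "lift_set (F ` X) i {x\<in>F ` X. x i \<in> G}" and ?V = "X \<inter> (\<lambda>x. F x i) -` G"
    \<comment> \<open>\<open>F x i\<close> depends only on the coordinates of \<open>x\<close> up to
      \<open>i\<close>, so \<open>?V\<close> is saturated.\<close>
    have "openin (top_of_set X) (lift_set X i ?V)"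
    proof (rule openin_lift_set_saturated[OF \<zeta> X i])
      show "openin (top_of_set X) ?V"
        using contF G by (rule continuous_openin_preimage_gen)
      show "y \<in> ?V" if "x \<in> ?V" "y \<in> X" "\<forall>j\<le>i. x j = y j" for x y
      proof -
        have "F x i = F y i" using that resp_le[OF i, of x y] by blast
        then show ?thesis using that by simp
      qed
    qed
    \<comment> \<open>Agreement below \<open>i\<close> means the same before and after
      \<open>F\<close>, so lifting commutes with taking preimages.\<close>
    also have "lift_set X i ?V = X \<inter> F -` ?L"
    proof -
      have V: "{y \<in> F ` X. y i \<in> G} = F ` ?V" by auto
      have "F u \<in> ?L \<longleftrightarrow> u \<in> lift_set X i ?V" if u: "u \<in> X" for u
      proof -
        have "F u \<in> F ` X" using u by blast
        then have "F u \<in> ?L \<longleftrightarrow> (\<exists>y\<in>?V. \<forall>j<i. F u j = F y j)"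
          by (simp only: lift_set_def mem_Collect_eq simp_thms V bex_simps)
        also have "\<dots> \<longleftrightarrow> (\<exists>y\<in>?V. \<forall>j<i. u j = y j)"
          using resp_lt[OF i u] by (intro bex_cong refl) simp
        finally show ?thesis using u by (simp add: lift_set_def)
      qed
      then show ?thesis by (auto simp: lift_set_def[of X])
    qed
    finally show ?thesis
      using Abstract_Topology_2.continuous_imp_quotient_map[OF cont refl compX, of ?L]
      by (auto simp: lift_set_def)
  qed
  show "glueing \<zeta> (F ` X)"
    unfolding glueing_def
  proof (intro ballI impI)
    fix \<xi> \<eta> y y'
    assume *: "\<xi> \<in> initial_sets" "\<eta> \<in> initial_sets" "\<xi> \<union> \<eta> \<subseteq> \<zeta>" "y \<in> F ` X" "y' \<in> F ` X"
      and eq: "\<forall>i\<in>\<xi> \<inter> \<eta>. y i = y' i"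
    obtain x x' where x: "x \<in> X" "x' \<in> X" "y = F x" "y' = F x'" using * by blast
    have "\<xi> \<inter> \<eta> \<in> initial_sets" "\<xi> \<inter> \<eta> \<subseteq> \<zeta>"
      using * by (auto simp: initial_sets_def)
    then have "\<forall>i\<in>\<xi> \<inter> \<eta>. x i = x' i"
      using resp[of "\<xi> \<inter> \<eta>" x x'] x eq by blast
    then obtain w where w: "w \<in> X" "\<forall>i\<in>\<xi>. w i = x i" "\<forall>i\<in>\<eta>. w i = x' i"
      using X glueingD[OF _ *(1-3) x(1,2)] by (auto simp: IPS'_iff[OF \<zeta>])
    then have "\<forall>i\<in>\<xi>. F w i = F x i" "\<forall>i\<in>\<eta>. F w i = F x' i"
      using resp[of \<xi> w x] resp[of \<eta> w x'] x * by blast+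
    then show "\<exists>w\<in>F ` X. (\<forall>i\<in>\<xi>. w i = y i) \<and> (\<forall>i\<in>\<eta>. w i = y' i)"
      using w x by blast
  qed
qed

section \<open>Stem lengths of sets of binary sequences\<close>

lemma stem_length_eqI:
  assumes "\<And>c d n. c \<in> A \<Longrightarrow> d \<in> A \<Longrightarrow> n < l \<Longrightarrow> c n = d n"
    and cd: "c \<in> A" "d \<in> A" "c l \<noteq> d l"
  shows "stem_length A = l"
  unfolding stem_length_def
proof (rule Greatest_equality)
  show "\<exists>s::bool list. length s = l \<and> (\<forall>a\<in>A. map a [0..<l] = s)"
    using assms by (intro exI[of _ "map c [0..<l]"]) auto
  fix n assume "\<exists>s::bool list. length s = n \<and> (\<forall>a\<in>A. map a [0..<n] = s)"
  then have "map c [0..<n] = map d [0..<n]" using cd by metis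
  then show "n \<le> l"
    using cd(3) by (metis atLeastLessThan_iff atLeastLessThan_upt le0 map_eq_conv not_le_imp_less)
qed

text \<open>The stem length is the least position at which two elements differ; having only two
  values, the digits there take both.\<close>

lemma stem_length_works:
  assumes "a \<in> A" "b \<in> A" "a \<noteq> b"
  shows "\<And>c d n. c \<in> A \<Longrightarrow> d \<in> A \<Longrightarrow> n < stem_length A \<Longrightarrow> c n = d n"
    and "\<exists>c\<in>A. c (stem_length A) = e"
proof -
  define l where "l = (LEAST n. \<exists>c\<in>A. \<exists>d\<in>A. c n \<noteq> d n)"
  have "\<exists>n. \<exists>c\<in>A. \<exists>d\<in>A. c n \<noteq> d n"
    using assms by (auto simp: fun_eq_iff)
  then have "\<exists>c\<in>A. \<exists>d\<in>A. c l \<noteq> d l"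
    unfolding l_def by (rule LeastI_ex)
  moreover have lt: "c n = d n" if "c \<in> A" "d \<in> A" "n < l" for c d n
    using not_less_Least[of n "\<lambda>n. \<exists>c\<in>A. \<exists>d\<in>A. c n \<noteq> d n"] that unfolding l_def by blast
  ultimately have l: "stem_length A = l" "\<exists>c\<in>A. \<exists>d\<in>A. c l \<noteq> d l"
    using stem_length_eqI by blast+
  show "\<exists>c\<in>A. c (stem_length A) = e"
    using l by (metis (full_types))
  show "c n = d n" if "c \<in> A" "d \<in> A" "n < stem_length A" for c d n
    using lt l that by simp
qed

subsection \<open>Splitting preserves the class of iterated perfect sets\<close>

definition stem_at :: "('i::order \<Rightarrow> cantor) set \<Rightarrow> 'i \<Rightarrow> ('i \<Rightarrow> cantor) \<Rightarrow> nat" where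
  "stem_at X i x = stem_length (fiber X (restrict x {..<i}) i)"

lemma stem_at_cong:
  "\<forall>j<i. x j = y j \<Longrightarrow> stem_at X i x = stem_at X i y"
  by (simp add: stem_at_def restrict_eq_iff[THEN iffD2, of "{..<i}" x y])

text \<open>\<open>x i\<close> always lies in its own fiber, so only the condition on the digit at
  the stem remains.\<close>

lemma Spl_at_eq: "Spl_at X i e = {x\<in>X. x i (stem_at X i x) = e}"
  by (auto simp: Spl_at_def Spl_def stem_at_def mem_fiber)

context
  fixes \<zeta> :: "'i::{order,countable} set" and X
  assumes \<zeta>: "\<zeta> \<in> initial_sets" and X: "X \<in> IPS' \<zeta>"
begin

text \<open>A perfect set cannot be \<open>{x i}\<close>, since removing the point would leave the
  closed empty set. Hence the stems of all fibers are meaningful.\<close>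

lemma fiber_two_points:
  assumes "i \<in> \<zeta>" "x \<in> X"
  shows "\<exists>y\<in>X. (\<forall>j<i. y j = x j) \<and> y i \<noteq> x i"
proof (rule ccontr)
  let ?A = "fiber X (restrict x {..<i}) i"
  assume "\<not> ?thesis"
  then have "?A - {x i} = {}"
    unfolding set_eq_iff Diff_iff mem_fiber by blast
  moreover have "perfect ?A" "x i \<in> ?A"
    using assms X by (auto simp: IPS'_iff[OF \<zeta>] mem_fiber)
  ultimately show False
    by (metis closed_empty perfect_iff)
qed

lemma stem_at_agree:
  assumes "i \<in> \<zeta>" "x \<in> X" "y \<in> X" "\<forall>j<i. y j = x j" "n < stem_at X i x"
  shows "y i n = x i n"
proof -
  obtain z where "z \<in> X" "\<forall>j<i. z j = x j" "z i \<noteq> x i"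
    using fiber_two_points assms by blast
  then show ?thesis
    using stem_length_works(1)[of "x i" "fiber X (restrict x {..<i}) i" "z i" "y i" "x i" n] assms
    by (auto simp: mem_fiber stem_at_def)
qed

lemma Spl_at_extend:
  assumes "i \<in> \<zeta>" "x \<in> X"
  shows "\<exists>y\<in>Spl_at X i e. \<forall>j<i. y j = x j"
proof -
  let ?A = "fiber X (restrict x {..<i}) i"
  obtain z where "z \<in> X" "\<forall>j<i. z j = x j" "z i \<noteq> x i"
    using fiber_two_points assms by blast
  then have "\<exists>c\<in>?A. c (stem_length ?A) = e"
    using stem_length_works(2)[of "x i" ?A "z i" e] assms by (auto simp: mem_fiber)
  then obtain y where "y \<in> X" "\<forall>j<i. y j = x j" "y i (stem_at X i x) = e"
    by (auto simp: mem_fiber stem_at_def)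
  then show ?thesis
    using stem_at_cong[of i y x X] by (intro bexI[of _ y]) (auto simp: Spl_at_eq)
qed

text \<open>Take \<open>y\<close> in the half \<open>e\<close> that agrees with \<open>x\<close>
  below \<open>i\<close>, and glue \<open>x\<close> on \<open>\<xi>\<close> to \<open>y\<close> on
  \<open>{..i}\<close>. The overlap lies below \<open>i\<close> because
  \<open>i \<notin> \<xi>\<close>, and the side of the split is decided by the coordinates up to
  \<open>i\<close>.\<close>

lemma Spl_at_extend_not_above:
  assumes i: "i \<in> \<zeta>" and x: "x \<in> X" and \<xi>: "\<xi> \<in> initial_sets" "\<xi> \<subseteq> \<zeta>" "i \<notin> \<xi>"
  shows "\<exists>y\<in>Spl_at X i e. \<forall>j\<in>\<xi>. y j = x j"
proof -
  obtain y where y: "y \<in> Spl_at X i e" "\<forall>j<i. y j = x j"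
    using Spl_at_extend[OF i x] by blast
  have "\<xi> \<inter> {..i} \<subseteq> {..<i}" using \<xi> by (auto simp: le_less)
  then have eq: "\<forall>j\<in>\<xi> \<inter> {..i}. x j = y j" using y by auto
  have "y \<in> X" using y by (simp add: Spl_at_eq)
  have "glueing \<zeta> X" using X by (simp add: IPS'_iff[OF \<zeta>])
  then obtain w where w: "w \<in> X" "\<forall>j\<in>\<xi>. w j = x j" "\<forall>j\<in>{..i}. w j = y j"
    using glueingD[OF _ \<xi>(1) atMost_initial Un_least[OF \<xi>(2) atMost_subset[OF \<zeta> i]] x \<open>y \<in> X\<close> eq]
    by blast
  moreover have "stem_at X i w = stem_at X i y"
    using w(3) by (intro stem_at_cong) auto
  ultimately show ?thesis
    using y(1) by (auto simp: Spl_at_eq)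
qed

text \<open>Near \<open>x\<close> the stem keeps the length \<open>l\<close>, and membership becomes
  the clopen condition that digit \<open>l\<close> be \<open>e\<close>.\<close>

lemma openin_Spl_at:
  assumes i: "i \<in> \<zeta>"
  shows "openin (top_of_set X) (Spl_at X i e)"
proof (subst openin_subopen, intro ballI)
  fix x assume x: "x \<in> Spl_at X i e"
  then have xX: "x \<in> X" by (simp add: Spl_at_eq)
  define l where "l = stem_at X i x"
  have xl: "x i l = e" using x by (simp add: Spl_at_eq l_def)
  define C where "C = {c::cantor. \<forall>n<l. c n = x i n}"
  define D where "D = (\<lambda>e. {c::cantor. c l = e})"
  have Dclopen: "open (D e)" "closed (D e)" for e
  proof -
    have "closed (D e)" for e
      unfolding D_def by (intro closed_Collect_eq continuous_on_eval continuous_on_const)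
    moreover have "D e = - D (\<not> e)" by (auto simp: D_def)
    ultimately show "open (D e)" "closed (D e)" by (metis open_Compl)+
  qed
  have Cclopen: "open C" "closed C"
  proof -
    have C: "C = (\<Inter>n\<in>{..<l}. {c. c n = x i n})" by (auto simp: C_def)
    show "closed C" unfolding C
      by (intro closed_INT ballI closed_Collect_eq continuous_on_eval continuous_on_const)
    have "open {c. c n = x i n}" for n
    proof -
      have "closed {c. c n = (\<not> x i n)}"
        by (intro closed_Collect_eq continuous_on_eval continuous_on_const)
      moreover have "{c. c n = x i n} = - {c. c n = (\<not> x i n)}" by auto
      ultimately show ?thesis by (metis open_Compl)
    qed
    then show "open C" unfolding C by (intro open_INT) auto
  qed
  have clX: "closed X" using X by (simp add: IPS'_iff[OF \<zeta>])
  \<comment> \<open>\<open>?T3\<close> keeps the whole fiber through \<open>w\<close> in the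
    cylinder \<open>C\<close>, so its elements agree below \<open>l\<close>; \<open>?T1\<close> and
    \<open>?T2\<close> provide elements of it with both digits at \<open>l\<close>.\<close>
  let ?T1 = "X \<inter> (\<lambda>y. y i) -` (C \<inter> D e)"
    and ?T2 = "lift_set X i {y\<in>X. y i \<in> C \<inter> D (\<not> e)}"
    and ?T3 = "X - lift_set X i {y\<in>X. y i \<in> - C}"
  have "openin (top_of_set X) ?T1"
    by (intro continuous_openin_preimage_gen[OF continuous_on_eval] open_Int Cclopen Dclopen)
  moreover have "openin (top_of_set X) ?T2"
    using X i open_Int[OF Cclopen(1) Dclopen(1)] unfolding IPS'_iff[OF \<zeta>] by blast
  moreover have "openin (top_of_set X) ?T3"
  proof -
    have "closed (X \<inter> (\<lambda>y. y i) -` (- C))"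
      using Cclopen clX by (intro continuous_closed_preimage[OF continuous_on_eval]) auto
    also have "X \<inter> (\<lambda>y. y i) -` (- C) = {y\<in>X. y i \<in> - C}" by auto
    finally have "closed (lift_set X i {y\<in>X. y i \<in> - C})"
      using clX by (intro closed_lift_set)
    then show ?thesis
      by (simp add: openin_diff closed_subset lift_set_def)
  qed
  ultimately have op: "openin (top_of_set X) (?T1 \<inter> ?T2 \<inter> ?T3)"
    by (rule openin_Int[OF openin_Int])
  have sub: "?T1 \<inter> ?T2 \<inter> ?T3 \<subseteq> Spl_at X i e"
  proof
    fix w assume w: "w \<in> ?T1 \<inter> ?T2 \<inter> ?T3"
    then obtain y where y: "y \<in> X" "\<forall>j<i. w j = y j" "y i l = (\<not> e)"
      unfolding lift_set_def D_def by blast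
    have "stem_at X i w = l"
      unfolding stem_at_def
    proof (rule stem_length_eqI)
      fix c d n assume "c \<in> fiber X (restrict w {..<i}) i" "d \<in> fiber X (restrict w {..<i}) i" "n < l"
      moreover have "c \<in> C" if "c \<in> fiber X (restrict w {..<i}) i" for c
        using w that by (force simp: lift_set_def mem_fiber)
      ultimately show "c n = d n" by (auto simp: C_def)
    next
      show "w i \<in> fiber X (restrict w {..<i}) i" "y i \<in> fiber X (restrict w {..<i}) i"
        using w y by (auto simp: mem_fiber)
      show "w i l \<noteq> y i l" using w y by (auto simp: D_def)
    qed
    then show "w \<in> Spl_at X i e" using w by (auto simp: Spl_at_eq D_def)
  qed
  have mem: "x \<in> ?T1 \<inter> ?T2 \<inter> ?T3"
  proof -
    have C: "y i \<in> C" if "y \<in> X" "\<forall>j<i. y j = x j" for y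
      using stem_at_agree[OF i xX that] by (auto simp: C_def l_def)
    obtain y where y: "y \<in> Spl_at X i (\<not> e)" "\<forall>j<i. y j = x j"
      using Spl_at_extend[OF i xX] by blast
    have yX: "y \<in> X" and "y i l = (\<not> e)"
      using y(1) stem_at_cong[OF y(2), of X] by (simp_all add: Spl_at_eq l_def)
    then have "y \<in> {y\<in>X. y i \<in> C \<inter> D (\<not> e)}"
      using C[OF yX y(2)] by (simp add: D_def)
    then have T2: "x \<in> ?T2"
      unfolding lift_set_def using xX y(2) by (intro CollectI conjI bexI[of _ y]) auto
    have T3: "x \<in> ?T3"
    proof -
      have "y i \<in> C" if "y \<in> X" "\<forall>j<i. x j = y j" for y
        using C[OF that(1)] that(2) by metis
      then show ?thesis unfolding lift_set_def using xX by blast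
    qed
    have T1: "x \<in> ?T1" using xX xl C[OF xX] by (simp add: D_def)
    show ?thesis by (rule IntI[OF IntI[OF T1 T2] T3])
  qed
  show "\<exists>T. openin (top_of_set X) T \<and> x \<in> T \<and> T \<subseteq> Spl_at X i e"
    by (rule exI[where x = "?T1 \<inter> ?T2 \<inter> ?T3"]) (intro conjI op mem sub)
qed

lemma closed_Spl_at:
  assumes i: "i \<in> \<zeta>"
  shows "closed (Spl_at X i e)"
proof -
  have "closed X" using X by (simp add: IPS'_iff[OF \<zeta>])
  moreover have "Spl_at X i e = X - Spl_at X i (\<not> e)" by (auto simp: Spl_at_eq)
  moreover have "closedin (top_of_set X) (X - Spl_at X i (\<not> e))"
    using openin_Spl_at[OF i, of "\<not> e"] by (simp add: closedin_diff)
  ultimately show ?thesis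
    using closedin_closed_trans by fastforce
qed

lemma Spl_at_saturated:
  assumes "x \<in> Spl_at X i e" "y \<in> X" "\<forall>j\<le>i. x j = y j"
  shows "y \<in> Spl_at X i e"
  using assms stem_at_cong[of i x y X] by (auto simp: Spl_at_eq)

text \<open>There are three kinds of coordinates. At \<open>i\<close> the fiber is cut by a clopen
  digit condition; at \<open>j\<close> above \<open>i\<close> the half is already decided below
  \<open>j\<close>; at any other \<open>j\<close> each point of \<open>X\<close> can be moved into
  the half with its coordinates up to \<open>j\<close> kept.\<close>

lemma IPS'_Spl_at:
  assumes i: "i \<in> \<zeta>"
  shows "Spl_at X i e \<in> IPS' \<zeta>"
  unfolding IPS'_iff[OF \<zeta>]
proof (intro conjI ballI allI impI)
  let ?S = "Spl_at X i e"
  have SX: "?S \<subseteq> X" by (auto simp: Spl_at_eq)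
  have Xext: "X \<subseteq> PiE \<zeta> (\<lambda>_. UNIV)" and Xne: "X \<noteq> {}"
    using X by (auto simp: IPS'_iff[OF \<zeta>])
  show "?S \<subseteq> PiE \<zeta> (\<lambda>_. UNIV)"
    using SX Xext by blast
  show "closed ?S" by (rule closed_Spl_at[OF i])
  show "?S \<noteq> {}"
    using Xne Spl_at_extend[OF i] by blast
  have opS: "openin (top_of_set X) V" if "openin (top_of_set ?S) V" for V
    using openin_Spl_at[OF i] that openin_trans by blast
  have ext: "\<exists>y\<in>?S. \<forall>k\<le>j. y k = x k" if "j \<in> \<zeta>" "\<not> i \<le> j" "x \<in> X" for j x
    using Spl_at_extend_not_above[OF i that(3) atMost_initial[of j] atMost_subset[OF \<zeta> that(1)], where e = e] that
    by auto
  show "perfect (fiber ?S (restrict x {..<j}) j)" if j: "j \<in> \<zeta>" and x: "x \<in> ?S" for j x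
  proof -
    have P: "perfect (fiber X (restrict x {..<j}) j)"
      using X j x SX by (auto simp: IPS'_iff[OF \<zeta>])
    show ?thesis
    proof (cases "j = i")
      case True
      let ?C = "{c. c (stem_at X i x) = e}"
      have "fiber ?S (restrict x {..<j}) j = fiber X (restrict x {..<j}) j \<inter> ?C"
      proof (intro set_eqI)
        fix c
        have "y \<in> ?S \<longleftrightarrow> y \<in> X \<and> y i \<in> ?C" if "\<forall>k<i. y k = x k" for y
          using stem_at_cong[OF that, of X] by (simp add: Spl_at_eq)
        then show "c \<in> fiber ?S (restrict x {..<j}) j \<longleftrightarrow> c \<in> fiber X (restrict x {..<j}) j \<inter> ?C"
          unfolding True mem_fiber Int_iff by blast
      qed
      moreover have "closed {c::cantor. c n = e}" for n :: nat and e
        by (intro closed_Collect_eq continuous_on_eval continuous_on_const)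
      moreover have "?C = - {c. c (stem_at X i x) = (\<not> e)}" by auto
      ultimately show ?thesis
        using perfect_Int_clopen[OF P, of ?C] by (metis open_Compl)
    next
      case False
      have "fiber ?S (restrict x {..<j}) j = fiber X (restrict x {..<j}) j"
      proof (intro set_eqI iffI)
        fix c assume "c \<in> fiber X (restrict x {..<j}) j"
        then obtain y where y: "y \<in> X" "\<forall>k<j. y k = x k" "y j = c"
          by (auto simp: mem_fiber)
        show "c \<in> fiber ?S (restrict x {..<j}) j"
        proof (cases "i \<le> j")
          case True
          then have "i < j" using False by simp
          then have "y \<in> ?S"
            using y x by (intro Spl_at_saturated[OF x]) auto
          then show ?thesis using y by (auto simp: mem_fiber)
        next
          case False
          obtain w where w: "w \<in> ?S" "\<forall>k\<le>j. w k = y k"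
            using ext[OF j False y(1)] by blast
          then have "\<forall>k<j. w k = x k" "w j = c" using y by auto
          then show ?thesis using w(1) by (auto simp: mem_fiber)
        qed
      qed (use SX in \<open>auto simp: mem_fiber\<close>)
      then show ?thesis using P by simp
    qed
  qed
  show "openin (top_of_set ?S) (lift_set ?S j {x\<in>?S. x j \<in> G})" if j: "j \<in> \<zeta>" and G: "open G" for j G
  proof -
    have *: "openin (top_of_set ?S) (?S \<inter> L)" if L: "openin (top_of_set X) L" for L
    proof -
      obtain T where "open T" "L = X \<inter> T" using L by (auto simp: openin_open)
      moreover from this have "?S \<inter> L = ?S \<inter> T" using SX by blast
      ultimately show ?thesis by (simp add: openin_open_Int)
    qed
    show ?thesis
    proof (cases "i \<le> j")
      case True
      let ?V = "?S \<inter> (\<lambda>x. x j) -` G"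
      \<comment> \<open>Since \<open>i \<le> j\<close>, the coordinates up to \<open>j\<close>
        decide membership in \<open>?S\<close>, so \<open>?V\<close> is saturated at
        \<open>j\<close>.\<close>
      have "openin (top_of_set X) (lift_set X j ?V)"
      proof (rule openin_lift_set_saturated[OF \<zeta> X j])
        show "openin (top_of_set X) ?V"
          by (intro opS continuous_openin_preimage_gen[OF continuous_on_eval] G)
        show "y \<in> ?V" if "x \<in> ?V" "y \<in> X" "\<forall>k\<le>j. x k = y k" for x y
        proof -
          have "\<forall>k\<le>i. x k = y k" using that(3) True order_trans by blast
          then have "y \<in> ?S" using that Spl_at_saturated by blast
          then show ?thesis using that by simp
        qed
      qed
      from *[OF this] show ?thesis
        by (rule back_subst[where P = "openin _"]) (use SX in \<open>auto simp: lift_set_def\<close>)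
    next
      case False
      have "openin (top_of_set X) (lift_set X j {x\<in>X. x j \<in> G})"
        using X j G by (auto simp: IPS'_iff[OF \<zeta>])
      from *[OF this] show ?thesis
      proof (rule back_subst[where P = "openin _"])
        \<comment> \<open>A witness in \<open>X\<close> is replaced through \<open>ext\<close> by
          one in \<open>?S\<close> with the same coordinates up to \<open>j\<close>.\<close>
        show "?S \<inter> lift_set X j {x\<in>X. x j \<in> G} = lift_set ?S j {x\<in>?S. x j \<in> G}"
        proof (intro set_eqI iffI)
          fix x assume "x \<in> ?S \<inter> lift_set X j {x\<in>X. x j \<in> G}"
          then obtain y where y: "x \<in> ?S" "y \<in> X" "y j \<in> G" "\<forall>k<j. x k = y k"
            by (auto simp: lift_set_def)
          obtain w where w: "w \<in> ?S" "\<forall>k\<le>j. w k = y k"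
            using ext[OF j False y(2)] by blast
          then have "\<forall>k<j. x k = w k" "w j \<in> G" using y by auto
          then show "x \<in> lift_set ?S j {x\<in>?S. x j \<in> G}"
            using w y by (auto simp: lift_set_def)
        qed (use SX in \<open>auto simp: lift_set_def\<close>)
      qed
    qed
  qed
  show "glueing \<zeta> ?S"
    unfolding glueing_def
  proof (intro ballI impI)
    fix \<xi> \<eta> x y
    assume *: "\<xi> \<in> initial_sets" "\<eta> \<in> initial_sets" "\<xi> \<union> \<eta> \<subseteq> \<zeta>" "x \<in> ?S" "y \<in> ?S"
      and eq: "\<forall>i\<in>\<xi> \<inter> \<eta>. x i = y i"
    have "glueing \<zeta> X" using X by (simp add: IPS'_iff[OF \<zeta>])
    then obtain w where w: "w \<in> X" "\<forall>i\<in>\<xi>. w i = x i" "\<forall>i\<in>\<eta>. w i = y i"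
      using glueingD[OF _ *(1-3) subsetD[OF SX *(4)] subsetD[OF SX *(5)] eq] by blast
    show "\<exists>w\<in>?S. (\<forall>i\<in>\<xi>. w i = x i) \<and> (\<forall>i\<in>\<eta>. w i = y i)"
    \<comment> \<open>If \<open>i\<close> is in the union, \<open>w\<close> agrees up to
      \<open>i\<close> with \<open>x\<close> or \<open>y\<close> and so lies in the half. Otherwise
      it is moved into the half with its coordinates in the union kept.\<close>
    proof (cases "i \<in> \<xi> \<union> \<eta>")
      case True
      then have "w \<in> ?S"
      proof
        assume "i \<in> \<xi>"
        then show ?thesis
          using Spl_at_saturated[OF *(4) w(1)] w(2) initial_setsD[OF *(1)] by metis
      next
        assume "i \<in> \<eta>"
        then show ?thesis
          using Spl_at_saturated[OF *(5) w(1)] w(3) initial_setsD[OF *(2)] by metis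
      qed
      then show ?thesis using w by blast
    next
      case False
      have "\<xi> \<union> \<eta> \<in> initial_sets" using * by (auto simp: initial_sets_def)
      then obtain w' where "w' \<in> ?S" "\<forall>i\<in>\<xi> \<union> \<eta>. w' i = w i"
        using Spl_at_extend_not_above[OF i w(1) _ *(3) False, of e] by blast
      moreover from this have "(\<forall>i\<in>\<xi>. w' i = x i) \<and> (\<forall>i\<in>\<eta>. w' i = y i)"
        using w(2,3) by simp
      ultimately show ?thesis by blast
    qed
  qed
qed

end

section \<open>Projections of splittings to initial sets\<close>

lemma in_projE:
  assumes "restrict x \<xi> \<in> proj Y \<xi>"
  obtains y where "y \<in> Y" "\<forall>j\<in>\<xi>. x j = y j"
proof -
  obtain y where "y \<in> Y" "restrict x \<xi> = restrict y \<xi>"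
    using assms by (auto simp: proj_def)
  then show thesis using that[of y] by (simp only: restrict_eq_iff)
qed

text \<open>A fiber at \<open>i\<close> involves only coordinates up to \<open>i\<close>, all of
  which lie in \<open>\<xi>\<close>.\<close>

lemma fiber_proj_cong:
  assumes "proj X \<xi> = proj Y \<xi>" "\<xi> \<in> initial_sets" "i \<in> \<xi>"
  shows "fiber X z i = fiber Y z i"
proof -
  have "fiber X z i \<subseteq> fiber Y z i" if eq: "proj X \<xi> = proj Y \<xi>" for X Y
  proof
    fix c assume "c \<in> fiber X z i"
    then obtain x where x: "x \<in> X" "restrict x {..<i} = z" "x i = c"
      by (auto simp: fiber_def)
    then have "restrict x \<xi> \<in> proj Y \<xi>"
      unfolding eq[symmetric] by (simp add: proj_def)
    then obtain y where y: "y \<in> Y" "\<forall>j\<in>\<xi>. x j = y j"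
      by (rule in_projE)
    have "restrict y {..<i} = restrict x {..<i}"
      using y(2) initial_setsD[OF assms(2,3)] by (auto simp: restrict_eq_iff)
    then show "c \<in> fiber Y z i"
      using x y assms(3) by (auto simp: fiber_def intro!: exI[of _ y])
  qed
  from this[OF assms(1)] this[OF assms(1)[symmetric]] show ?thesis by blast
qed

lemma stem_at_proj_cong:
  assumes "proj X \<xi> = proj Y \<xi>" "\<xi> \<in> initial_sets" "i \<in> \<xi>" "\<forall>j<i. x j = y j"
  shows "stem_at X i x = stem_at Y i y"
proof -
  have "restrict x {..<i} = restrict y {..<i}"
    using assms(4) by (simp add: restrict_eq_iff)
  then show ?thesis
    using fiber_proj_cong[OF assms(1-3)] by (simp add: stem_at_def)
qed

text \<open>The stem at \<open>i\<close> and the digit there are both visible in the projection to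
  \<open>\<xi>\<close>.\<close>

lemma proj_Spl_at_cong:
  assumes "proj X \<xi> = proj Y \<xi>" "\<xi> \<in> initial_sets" "i \<in> \<xi>"
  shows "proj (Spl_at X i e) \<xi> = proj (Spl_at Y i e) \<xi>"
proof -
  have "proj (Spl_at X i e) \<xi> \<subseteq> proj (Spl_at Y i e) \<xi>" if eq: "proj X \<xi> = proj Y \<xi>" for X Y
  proof
    fix z assume "z \<in> proj (Spl_at X i e) \<xi>"
    then obtain x where x: "x \<in> X" "x i (stem_at X i x) = e" "z = restrict x \<xi>"
      by (auto simp: proj_def Spl_at_eq)
    then have "z \<in> proj Y \<xi>"
      unfolding eq[symmetric] by (simp add: proj_def)
    then obtain y where y: "y \<in> Y" "z = restrict y \<xi>"
      by (auto simp: proj_def)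
    then have xy: "\<forall>j\<in>\<xi>. x j = y j" using x(3) by (simp add: restrict_eq_iff)
    then have "\<forall>j<i. x j = y j" using initial_setsD[OF assms(2,3)] by simp
    from stem_at_proj_cong[OF eq assms(2,3) this] have "y i (stem_at Y i y) = e"
      using x(2) xy assms(3) by simp
    then show "z \<in> proj (Spl_at Y i e) \<xi>"
      using y by (auto simp: proj_def Spl_at_eq)
  qed
  from this[OF assms(1)] this[OF assms(1)[symmetric]] show ?thesis by blast
qed

lemma proj_Spl_at_not_in:
  fixes \<zeta> :: "'i::{order,countable} set"
  assumes "\<zeta> \<in> initial_sets" "X \<in> IPS' \<zeta>" "i \<in> \<zeta>" "\<xi> \<in> initial_sets" "\<xi> \<subseteq> \<zeta>" "i \<notin> \<xi>"
  shows "proj (Spl_at X i e) \<xi> = proj X \<xi>"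
proof
  show "proj (Spl_at X i e) \<xi> \<subseteq> proj X \<xi>"
    by (auto simp: proj_def Spl_at_eq)
  show "proj X \<xi> \<subseteq> proj (Spl_at X i e) \<xi>"
  proof
    fix z assume "z \<in> proj X \<xi>"
    then obtain x where x: "x \<in> X" "z = restrict x \<xi>" by (auto simp: proj_def)
    obtain y where "y \<in> Spl_at X i e" "\<forall>j\<in>\<xi>. y j = x j"
      using Spl_at_extend_not_above[OF assms(1,2,3) x(1) assms(4-6)] by blast
    moreover from this have "z = restrict y \<xi>" using x(2) by (simp add: restrict_eq_iff)
    ultimately show "z \<in> proj (Spl_at X i e) \<xi>" by (auto simp: proj_def)
  qed
qed

subsection \<open>The coordinates given by an admissible function\<close>

text \<open>Indexing the stages by an infinite code makes them a decreasing sequence with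
  intersection \<open>split_inf X \<Phi> a\<close>.\<close>

definition branch :: "('i::order \<Rightarrow> cantor) set \<Rightarrow> (nat \<Rightarrow> 'i) \<Rightarrow> cantor \<Rightarrow> nat \<Rightarrow> ('i \<Rightarrow> cantor) set" where
  "branch X \<Phi> a m = split_fin X \<Phi> (map a [0..<m])"

lemma branch_0: "branch X \<Phi> a 0 = X"
  by (simp add: branch_def split_fin_Nil)

lemma branch_Suc: "branch X \<Phi> a (Suc m) = Spl_at (branch X \<Phi> a m) (\<Phi> m) (a m)"
  by (simp add: branch_def split_fin_snoc)

lemma branch_cong: "(\<And>k. k < m \<Longrightarrow> a k = b k) \<Longrightarrow> branch X \<Phi> a m = branch X \<Phi> b m"
  unfolding branch_def by (rule arg_cong[where f = "split_fin X \<Phi>"]) simp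

lemma split_inf_eq: "split_inf X \<Phi> a = (\<Inter>m. branch X \<Phi> a m)"
  by (simp add: split_inf_def branch_def)

lemma decseq_branch: "decseq (branch X \<Phi> a)"
  by (intro decseq_SucI) (auto simp: branch_Suc Spl_at_eq)

lemma branch_subset: "branch X \<Phi> a m \<subseteq> X"
  using decseqD[OF decseq_branch, of 0 m X \<Phi> a] by (simp add: branch_0)

lemma branch_SucD:
  assumes "x \<in> branch X \<Phi> a (Suc m)"
  shows "x (\<Phi> m) (stem_at (branch X \<Phi> a m) (\<Phi> m) x) = a m"
  using assms by (simp add: branch_Suc Spl_at_eq)

text \<open>At each stage one of the two halves contains \<open>x\<close>, and its digit continues
  the code.\<close>

lemma branch_exists:
  assumes "x \<in> X"
  shows "\<exists>a. \<forall>m. x \<in> branch X \<Phi> a m"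
proof -
  \<comment> \<open>The next digit depends on the earlier ones through the stage reached, so the
    recursion builds finite words; \<open>a m\<close> is the digit appended to
    \<open>u m\<close>.\<close>
  define u where "u = rec_nat [] (\<lambda>m w. w @ [x (\<Phi> m) (stem_at (split_fin X \<Phi> w) (\<Phi> m) x)])"
  define a where "a m = x (\<Phi> m) (stem_at (split_fin X \<Phi> (u m)) (\<Phi> m) x)" for m
  have u: "u m = map a [0..<m]" for m
    by (induction m) (simp_all add: u_def a_def)
  have a: "a m = x (\<Phi> m) (stem_at (branch X \<Phi> a m) (\<Phi> m) x)" for m
    unfolding branch_def u[symmetric] by (rule a_def)
  have "x \<in> branch X \<Phi> a m" for m
    by (induction m) (simp_all add: assms branch_0 branch_Suc Spl_at_eq flip: a)
  then show ?thesis by blast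
qed

lemma branch_unique:
  assumes "\<And>m. x \<in> branch X \<Phi> a m" "\<And>m. x \<in> branch X \<Phi> b m"
  shows "a = b"
proof
  fix m
  show "a m = b m"
  proof (induction m rule: less_induct)
    case (less m)
    then have "branch X \<Phi> a m = branch X \<Phi> b m" by (rule branch_cong)
    then show ?case
      using branch_SucD[OF assms(1)[of "Suc m"]] branch_SucD[OF assms(2)[of "Suc m"]] by simp
  qed
qed

text \<open>The point of \<open>X\<close> with code \<open>a\<close>; \<open>the_elem\<close> is
  meaningful because shrinkability makes the intersection a singleton for admissible
  \<open>\<Phi>\<close>.\<close>

definition branch_point :: "(nat \<Rightarrow> 'i) \<Rightarrow> ('i::order \<Rightarrow> cantor) set \<Rightarrow> cantor \<Rightarrow> 'i \<Rightarrow> cantor" where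
  "branch_point \<Phi> X a = the_elem (split_inf X \<Phi> a)"

text \<open>
  The coordinate index at which the fiber through \<open>a\<close> of the set with code \<open>S\<close> first splits;
  unspecified if no such index exists.
\<close>

definition split_index :: "(nat \<Rightarrow> 'i::order) \<Rightarrow> cantor set \<Rightarrow> 'i \<Rightarrow> cantor \<Rightarrow> nat" where
  "split_index \<Phi> S i a = (LEAST k. \<Phi> k = i \<and> (\<exists>b\<in>S. (\<forall>m. \<Phi> m < i \<longrightarrow> b m = a m) \<and> b k \<noteq> a k))"

context
  fixes \<zeta> :: "'i::{order,countable} set" and \<Phi> :: "nat \<Rightarrow> 'i"
  assumes \<zeta>: "\<zeta> \<in> initial_sets" and \<Phi>: "admissible \<zeta> \<Phi>"
begin

abbreviation "pt \<equiv> branch_point \<Phi>"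

lemma admissible_in: "\<Phi> m \<in> \<zeta>"
  using \<Phi> by (auto simp: admissible_def)

lemma IPS'_branch: "X \<in> IPS' \<zeta> \<Longrightarrow> branch X \<Phi> a m \<in> IPS' \<zeta>"
  by (induction m) (simp_all add: branch_0 branch_Suc IPS'_Spl_at[OF \<zeta>] admissible_in)

lemma openin_branch:
  assumes "X \<in> IPS' \<zeta>"
  shows "openin (top_of_set X) (branch X \<Phi> a m)"
proof (induction m)
  case (Suc m)
  then show ?case
    unfolding branch_Suc using openin_Spl_at[OF \<zeta> IPS'_branch[OF assms] admissible_in] openin_trans by blast
qed (simp add: branch_0)

text \<open>A split at an index outside \<open>\<xi>\<close> leaves the projection unchanged, and a
  split inside acts on the projection alone. Hence only the digits at positions with
  \<open>\<Phi> k \<in> \<xi>\<close> matter.\<close>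

lemma proj_branch_cong:
  assumes "X \<in> IPS' \<zeta>" "Y \<in> IPS' \<zeta>" "\<xi> \<in> initial_sets" "\<xi> \<subseteq> \<zeta>" "proj X \<xi> = proj Y \<xi>"
    and "\<And>k. k < m \<Longrightarrow> \<Phi> k \<in> \<xi> \<Longrightarrow> a k = b k"
  shows "proj (branch X \<Phi> a m) \<xi> = proj (branch Y \<Phi> b m) \<xi>"
  using assms(6)
proof (induction m)
  case (Suc m)
  then have IH: "proj (branch X \<Phi> a m) \<xi> = proj (branch Y \<Phi> b m) \<xi>" by simp
  show ?case
  proof (cases "\<Phi> m \<in> \<xi>")
    case True
    then show ?thesis
      using Suc.prems[of m] proj_Spl_at_cong[OF IH assms(3) True] by (simp add: branch_Suc)
  next
    case False
    then show ?thesis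
      using IH assms proj_Spl_at_not_in[OF \<zeta> IPS'_branch admissible_in, of _ \<xi>] by (simp add: branch_Suc)
  qed
qed (simp add: branch_0 assms(5))

section \<open>Points and their codes\<close>

lemma split_inf_pt:
  assumes "X \<in> IPS \<zeta>"
  shows "split_inf X \<Phi> a = {pt X a}"
proof -
  have "is_singleton (split_inf X \<Phi> a)"
    using assms \<Phi> by (simp add: IPS_def shrinkable_def)
  then show ?thesis by (simp add: branch_point_def is_singleton_the_elem)
qed

lemma pt_in_branch: "X \<in> IPS \<zeta> \<Longrightarrow> pt X a \<in> branch X \<Phi> a m"
  using split_inf_pt[of X a] by (auto simp: split_inf_eq)

lemma pt_in: "X \<in> IPS \<zeta> \<Longrightarrow> pt X a \<in> X"
  using pt_in_branch[of X a 0] by (simp add: branch_0)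

lemma pt_eqI: "X \<in> IPS \<zeta> \<Longrightarrow> (\<And>m. x \<in> branch X \<Phi> a m) \<Longrightarrow> x = pt X a"
  using split_inf_pt[of X a] by (auto simp: split_inf_eq)

lemma bij_betw_pt:
  assumes "X \<in> IPS \<zeta>"
  shows "bij_betw (pt X) UNIV X"
proof (rule bij_betw_imageI)
  show "inj (pt X)"
  proof (rule injI)
    fix a b assume "pt X a = pt X b"
    then show "a = b"
      using pt_in_branch[OF assms] by (intro branch_unique[of "pt X a" X \<Phi>]) metis+
  qed
  show "range (pt X) = X"
  proof
    show "X \<subseteq> range (pt X)"
    proof
      fix x assume "x \<in> X"
      then obtain a where "\<forall>m. x \<in> branch X \<Phi> a m" using branch_exists by blast
      then have "x = pt X a" using pt_eqI[OF assms] by blast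
      then show "x \<in> range (pt X)" by blast
    qed
  qed (use pt_in[OF assms] in blast)
qed

text \<open>At each finite stage some point of the branch of \<open>Y\<close> has the coordinates of
  \<open>pt X a\<close> on \<open>\<xi>\<close>. These points form nested nonempty closed sets; by
  compactness there is a common point, and shrinkability of \<open>Y\<close> identifies it as
  \<open>pt Y b\<close>.\<close>

lemma pt_agree:
  assumes X: "X \<in> IPS \<zeta>" and Y: "Y \<in> IPS \<zeta>" and \<xi>: "\<xi> \<in> initial_sets" "\<xi> \<subseteq> \<zeta>"
    and eq: "proj X \<xi> = proj Y \<xi>" and ab: "\<And>m. \<Phi> m \<in> \<xi> \<Longrightarrow> a m = b m"
  shows "\<forall>i\<in>\<xi>. pt X a i = pt Y b i"
proof -
  have X': "X \<in> IPS' \<zeta>" and Y': "Y \<in> IPS' \<zeta>" using X Y by (simp_all add: IPS_def)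
  define E where "E = (\<Inter>i\<in>\<xi>. {w::'i \<Rightarrow> cantor. w i = pt X a i})"
  have "closed E"
    unfolding E_def by (intro closed_INT ballI closed_Collect_eq continuous_on_eval continuous_on_const)
  have "(\<Inter>m. branch Y \<Phi> b m \<inter> E) \<noteq> {}"
  proof (rule compact_space_imp_nest[of euclidean])
    show "compact_space (euclidean :: ('i \<Rightarrow> cantor) topology)"
      by (simp add: compact_space_def compact_UNIV_power)
    show "closedin euclidean (branch Y \<Phi> b m \<inter> E)" for m
      using IPS'_branch[OF Y', of b m] \<open>closed E\<close> by (auto simp: IPS'_iff[OF \<zeta>])
    show "decseq (\<lambda>m. branch Y \<Phi> b m \<inter> E)"
      by (intro decseq_SucI Int_mono decseqD[OF decseq_branch]) auto
    show "branch Y \<Phi> b m \<inter> E \<noteq> {}" for m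
    proof -
      have "restrict (pt X a) \<xi> \<in> proj (branch X \<Phi> a m) \<xi>"
        using pt_in_branch[OF X] by (auto simp: proj_def)
      also have "\<dots> = proj (branch Y \<Phi> b m) \<xi>"
        using ab by (intro proj_branch_cong[OF X' Y' \<xi> eq])
      finally obtain w where w: "w \<in> branch Y \<Phi> b m" "\<forall>j\<in>\<xi>. pt X a j = w j"
        by (rule in_projE)
      then have "w \<in> E" by (simp add: E_def)
      then show ?thesis using w(1) by blast
    qed
  qed
  then obtain w where "\<And>m. w \<in> branch Y \<Phi> b m" "w \<in> E" by blast
  moreover from this have "w = pt Y b" using pt_eqI[OF Y] by blast
  ultimately show ?thesis by (simp add: E_def)
qed

text \<open>For the forward direction the digits are recovered in order: equal earlier digits give
  stages with equal projections, hence equal stems, and digit \<open>m\<close> is read from the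
  value at \<open>\<Phi> m\<close> in the stem position.\<close>

lemma pt_agree_iff:
  assumes X: "X \<in> IPS \<zeta>" and \<xi>: "\<xi> \<in> initial_sets" "\<xi> \<subseteq> \<zeta>"
  shows "(\<forall>i\<in>\<xi>. pt X a i = pt X b i) \<longleftrightarrow> (\<forall>m. \<Phi> m \<in> \<xi> \<longrightarrow> a m = b m)"
proof
  assume eq: "\<forall>i\<in>\<xi>. pt X a i = pt X b i"
  have "a m = b m" if "\<Phi> m \<in> \<xi>" for m
    using that
  proof (induction m rule: less_induct)
    case (less m)
    have X': "X \<in> IPS' \<zeta>" using X by (simp add: IPS_def)
    have P: "proj (branch X \<Phi> a m) \<xi> = proj (branch X \<Phi> b m) \<xi>"
      using less.IH by (intro proj_branch_cong[OF X' X' \<xi> refl])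
    have "\<forall>j<\<Phi> m. pt X a j = pt X b j"
      using eq initial_setsD[OF \<xi>(1) less.prems] by simp
    then have "stem_at (branch X \<Phi> a m) (\<Phi> m) (pt X a) = stem_at (branch X \<Phi> b m) (\<Phi> m) (pt X b)"
      by (rule stem_at_proj_cong[OF P \<xi>(1) less.prems])
    then show ?case
      using branch_SucD[OF pt_in_branch[OF X], of a m] branch_SucD[OF pt_in_branch[OF X], of b m]
        eq less.prems by simp
  qed
  then show "\<forall>m. \<Phi> m \<in> \<xi> \<longrightarrow> a m = b m" by blast
qed (use pt_agree[OF X X \<xi> refl] in blast)

text \<open>Fixing the digits up to \<open>n\<close> selects a branch, which is open in
  \<open>X\<close>; a condition on digit \<open>n\<close> is a union of such branches.\<close>

lemma continuous_on_inv_pt: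
  assumes "X \<in> IPS \<zeta>"
  shows "continuous_on X (inv (pt X))"
proof (rule continuous_on_coordinatewise_then_product)
  fix n
  have X': "X \<in> IPS' \<zeta>" using assms by (simp add: IPS_def)
  have bij: "bij_betw (pt X) UNIV X" by (rule bij_betw_pt[OF assms])
  show "continuous_on X (\<lambda>x. inv (pt X) x n)"
    unfolding continuous_openin_preimage_eq
  proof (intro allI impI)
    fix T :: "bool set"
    have "X \<inter> (\<lambda>x. inv (pt X) x n) -` T = (\<Union>a\<in>{a. a n \<in> T}. branch X \<Phi> a (Suc n))"
    proof (intro set_eqI iffI)
      fix x assume x: "x \<in> X \<inter> (\<lambda>x. inv (pt X) x n) -` T"
      then have "pt X (inv (pt X) x) = x"
        using bij by (simp add: bij_betw_inv_into_right)
      then have "x \<in> branch X \<Phi> (inv (pt X) x) (Suc n)"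
        using pt_in_branch[OF assms] by metis
      then show "x \<in> (\<Union>a\<in>{a. a n \<in> T}. branch X \<Phi> a (Suc n))" using x by blast
    next
      fix x assume "x \<in> (\<Union>a\<in>{a. a n \<in> T}. branch X \<Phi> a (Suc n))"
      then obtain a where a: "a n \<in> T" "x \<in> branch X \<Phi> a (Suc n)" by blast
      then have "x \<in> X" using branch_subset by blast
      then obtain b where b: "x = pt X b" using bij by (auto simp: bij_betw_def)
      \<comment> \<open>Membership of \<open>x\<close> in stage \<open>Suc n\<close> along
        \<open>a\<close> already forces the digits of \<open>a\<close> up to \<open>n\<close> to be
        those of the code of \<open>x\<close>.\<close>
      have "a k = b k" if "k \<le> n" for k
        using that
      proof (induction k rule: less_induct)
        case (less k)
        then have "branch X \<Phi> a k = branch X \<Phi> b k" by (intro branch_cong) simp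
        moreover have "x \<in> branch X \<Phi> a (Suc k)"
          using a(2) decseqD[OF decseq_branch, of "Suc k" "Suc n" X \<Phi> a] less.prems by auto
        ultimately show ?case
          using branch_SucD[of x X \<Phi> a k] branch_SucD[OF pt_in_branch[OF assms], of b k] b by simp
      qed
      moreover have "inv (pt X) x = b"
        using bij b by (simp add: bij_betw_def)
      ultimately show "x \<in> X \<inter> (\<lambda>x. inv (pt X) x n) -` T"
        using a \<open>x \<in> X\<close> by simp
    qed
    then show "openin (top_of_set X) (X \<inter> (\<lambda>x. inv (pt X) x n) -` T)"
      using openin_branch[OF X'] by (auto intro: openin_Union)
  qed
qed

lemma continuous_on_pt:
  assumes "X \<in> IPS \<zeta>"
  shows "continuous_on UNIV (pt X)"
proof -
  have bij: "bij_betw (pt X) UNIV X" by (rule bij_betw_pt[OF assms])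
  have "compact X"
    using assms by (auto simp: IPS_def IPS'_iff[OF \<zeta>] compact_iff_closed_power)
  then have "continuous_on (inv (pt X) ` X) (pt X)"
    using continuous_on_inv[OF continuous_on_inv_pt[OF assms]] bij
    by (simp add: bij_betw_inv_into_right)
  moreover have "inv (pt X) ` X = UNIV"
    using bij bij_betw_inv_into[OF bij] by (simp add: bij_betw_def)
  ultimately show ?thesis by simp
qed

text \<open>The position on the left depends on \<open>X\<close>, the one on the right only on
  codes. This permits comparing splittings of subsets of different sets.\<close>

lemma split_index_works:
  assumes X: "X \<in> IPS \<zeta>" and S: "pt X ` S \<in> IPS' \<zeta>" and i: "i \<in> \<zeta>" and a: "a \<in> S"
  shows "pt X a i (stem_at (pt X ` S) i (pt X a)) = a (split_index \<Phi> S i a)"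
proof -
  have X': "X \<in> IPS' \<zeta>" using X by (simp add: IPS_def)
  \<comment> \<open>\<open>T\<close> collects the codes in \<open>S\<close> of the points that form
    the fiber through \<open>pt X a\<close> at \<open>i\<close>.\<close>
  define T where "T = {b\<in>S. \<forall>m. \<Phi> m < i \<longrightarrow> b m = a m}"
  define k where "k = split_index \<Phi> S i a"
  have T: "b \<in> T \<longleftrightarrow> b \<in> S \<and> (\<forall>j<i. pt X b j = pt X a j)" for b
    using pt_agree_iff[OF X lessThan_initial lessThan_subset[OF \<zeta> i], of b a] by (simp add: T_def Ball_def)
  have fib: "c \<in> fiber (pt X ` S) (restrict (pt X a) {..<i}) i \<longleftrightarrow> (\<exists>b\<in>T. c = pt X b i)" for c
    using T by (auto simp: mem_fiber)
  have "\<exists>k. \<Phi> k = i \<and> (\<exists>b\<in>T. b k \<noteq> a k)"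
  proof -
    obtain b where b: "b \<in> T" "pt X b i \<noteq> pt X a i"
      using fiber_two_points[OF \<zeta> S i imageI[OF a]] T by blast
    \<comment> \<open>Points that differ on \<open>{..i}\<close> have codes differing at some
      \<open>k\<close> with \<open>\<Phi> k \<le> i\<close>, and membership in \<open>T\<close>
      excludes \<open>\<Phi> k < i\<close>.\<close>
    then have "\<not> (\<forall>j\<in>{..i}. pt X b j = pt X a j)" by auto
    then obtain k where "\<Phi> k \<le> i" "b k \<noteq> a k"
      using pt_agree_iff[OF X atMost_initial atMost_subset[OF \<zeta> i], of b a] by auto
    moreover from this have "\<Phi> k = i"
      using b(1) by (auto simp: T_def le_less)
    ultimately show ?thesis using b(1) by blast
  qed
  moreover have k_Least: "k = (LEAST k. \<Phi> k = i \<and> (\<exists>b\<in>T. b k \<noteq> a k))"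
    unfolding k_def split_index_def T_def by (rule arg_cong[where f = Least]) auto
  ultimately have k: "\<Phi> k = i" "\<exists>b\<in>T. b k \<noteq> a k"
    using LeastI_ex[of "\<lambda>k. \<Phi> k = i \<and> (\<exists>b\<in>T. b k \<noteq> a k)"] by simp_all
  have below_k: "b m = a m" if "b \<in> T" "m < k" "\<Phi> m \<le> i" for b m
  proof (cases "\<Phi> m = i")
    case True
    then show ?thesis
      using not_less_Least[of m "\<lambda>k. \<Phi> k = i \<and> (\<exists>b\<in>T. b k \<noteq> a k)"] that k_Least by blast
  next
    case False
    then show ?thesis using that by (auto simp: T_def le_less)
  qed
  \<comment> \<open>Codes in \<open>T\<close> agree with \<open>a\<close> before \<open>k\<close> at
    all positions that concern \<open>{..i}\<close>, so their stages \<open>k\<close> look alike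
    there.\<close>
  have P: "proj (branch X \<Phi> b k) {..i} = proj (branch X \<Phi> a k) {..i}" if "b \<in> T" for b
    using below_k[OF that] by (intro proj_branch_cong[OF X' X' atMost_initial atMost_subset[OF \<zeta> i] refl]) simp
  \<comment> \<open>\<open>l\<close> is where stage \<open>k\<close> splits at \<open>i\<close>. The
    points with codes in \<open>T\<close> agree at \<open>i\<close> below \<open>l\<close>, and
    their digit \<open>l\<close> is the code digit \<open>k\<close>, which takes both values on
    \<open>T\<close>; so \<open>l\<close> is also the stem of the subset's fiber.\<close>
  define l where "l = stem_at (branch X \<Phi> a k) i (pt X a)"
  have at_l: "pt X b i l = b k" if b: "b \<in> T" for b
  proof -
    have "stem_at (branch X \<Phi> b k) i (pt X b) = l"
      unfolding l_def using b T by (intro stem_at_proj_cong[OF P[OF b] atMost_initial]) auto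
    then show ?thesis
      using branch_SucD[OF pt_in_branch[OF X], of b k] k(1) by simp
  qed
  have below_l: "pt X b i n = pt X a i n" if b: "b \<in> T" and n: "n < l" for b n
  proof -
    have "restrict (pt X b) {..i} \<in> proj (branch X \<Phi> b k) {..i}"
      using pt_in_branch[OF X] by (auto simp: proj_def)
    then obtain y where y: "y \<in> branch X \<Phi> a k" "\<forall>j\<in>{..i}. pt X b j = y j"
      unfolding P[OF b] by (rule in_projE)
    have "\<forall>j<i. y j = pt X a j" using y(2) b T by auto
    then have "y i n = pt X a i n"
      using stem_at_agree[OF \<zeta> IPS'_branch[OF X'] i pt_in_branch[OF X] y(1)] n by (simp add: l_def)
    then show ?thesis using y(2) by simp
  qed
  have aT: "a \<in> T" using a by (simp add: T_def)
  obtain b where b: "b \<in> T" "b k \<noteq> a k" using k(2) by blast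
  have "stem_at (pt X ` S) i (pt X a) = l"
    unfolding stem_at_def
  proof (rule stem_length_eqI)
    show "pt X a i \<in> fiber (pt X ` S) (restrict (pt X a) {..<i}) i"
      and "pt X b i \<in> fiber (pt X ` S) (restrict (pt X a) {..<i}) i"
      using fib aT b(1) by blast+
    show "pt X a i l \<noteq> pt X b i l" using at_l[OF aT] at_l[OF b(1)] b(2) by simp
    fix c d n assume "c \<in> fiber (pt X ` S) (restrict (pt X a) {..<i}) i"
      "d \<in> fiber (pt X ` S) (restrict (pt X a) {..<i}) i" "n < l"
    then show "c n = d n" using fib below_l by metis
  qed
  then show ?thesis using at_l[OF aT] by (simp add: k_def)
qed

lemma IPS'_split_fin:
  assumes "X \<in> IPS' \<zeta>" "range \<Psi> \<subseteq> \<zeta>"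
  shows "split_fin X \<Psi> u \<in> IPS' \<zeta>"
  by (induction u rule: rev_induct)
    (use assms in \<open>auto simp: split_fin_Nil split_fin_snoc intro!: IPS'_Spl_at[OF \<zeta>]\<close>)

text \<open>Here \<open>\<Psi>\<close> drives the splitting while \<open>\<Phi>\<close> supplies the
  codes. Corresponding stages have the same codes, and \<open>split_index_works\<close> decides the
  next split from these alone.\<close>

lemma pt_in_split_fin_iff:
  assumes X: "X \<in> IPS \<zeta>" and Y: "Y \<in> IPS \<zeta>"
    and S: "pt X ` S \<in> IPS' \<zeta>" "pt Y ` S \<in> IPS' \<zeta>" and \<Psi>: "range \<Psi> \<subseteq> \<zeta>"
  shows "pt X c \<in> split_fin (pt X ` S) \<Psi> u \<longleftrightarrow> pt Y c \<in> split_fin (pt Y ` S) \<Psi> u"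
proof (induction u arbitrary: c rule: rev_induct)
  case Nil
  have "inj (pt X)" "inj (pt Y)" using bij_betw_pt X Y by (auto simp: bij_betw_def)
  then show ?case by (simp add: split_fin_Nil inj_image_mem_iff)
next
  case (snoc e u)
  \<comment> \<open>The code set of the current stage, common to both sides by the induction
    hypothesis.\<close>
  define R where "R = {c. pt X c \<in> split_fin (pt X ` S) \<Psi> u}"
  have sub: "split_fin Z \<Psi> u \<subseteq> Z" for Z :: "('i \<Rightarrow> cantor) set"
    by (induction u rule: rev_induct) (auto simp: split_fin_Nil split_fin_snoc Spl_at_eq)
  have RX: "split_fin (pt X ` S) \<Psi> u = pt X ` R"
    using sub[of "pt X ` S"] by (auto simp: R_def)
  have RY: "split_fin (pt Y ` S) \<Psi> u = pt Y ` R"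
    using sub[of "pt Y ` S"] snoc.IH by (auto simp: R_def)
  have R: "pt X ` R \<in> IPS' \<zeta>" "pt Y ` R \<in> IPS' \<zeta>"
    unfolding RX[symmetric] RY[symmetric] by (intro IPS'_split_fin S \<Psi>)+
  have i: "\<Psi> (length u) \<in> \<zeta>" using \<Psi> by blast
  have inj: "inj (pt X)" "inj (pt Y)" using bij_betw_pt X Y by (auto simp: bij_betw_def)
  show ?case
    using split_index_works[OF X R(1) i, of c] split_index_works[OF Y R(2) i, of c]
    by (auto simp: split_fin_snoc RX RY Spl_at_eq inj_image_mem_iff[OF inj(1)] inj_image_mem_iff[OF inj(2)])
qed

lemma continuous_on_transfer:
  assumes "X \<in> IPS \<zeta>" "Y \<in> IPS \<zeta>"
  shows "continuous_on X (\<lambda>x. pt Y (inv (pt X) x))"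
  using continuous_on_compose2[OF continuous_on_pt[OF assms(2)] continuous_on_inv_pt[OF assms(1)]] by simp

lemma inv_pt:
  assumes "X \<in> IPS \<zeta>"
  shows "inv (pt X) (pt X a) = a" and "x \<in> X \<Longrightarrow> pt X (inv (pt X) x) = x"
  using bij_betw_pt[OF assms] bij_betw_inv_into_right[of "pt X" UNIV X x] by (simp_all add: bij_betw_def)

subsection \<open>Transfer along equal coordinates\<close>

text \<open>The clauses of \<open>IPS'\<close> pass along the code-preserving map by
  \<open>IPS'_image\<close>. For shrinkability, every splitting along every \<open>\<Psi>\<close>
  has the same codes on both sides, so singletons correspond.\<close>

lemma IPS_transfer:
  assumes X: "X \<in> IPS \<zeta>" and Y: "Y \<in> IPS \<zeta>" and S: "pt X ` S \<in> IPS \<zeta>"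
  shows "pt Y ` S \<in> IPS \<zeta>"
proof -
  let ?F = "\<lambda>x. pt Y (inv (pt X) x)"
  have SX: "pt X ` S \<in> IPS' \<zeta>" using S by (simp add: IPS_def)
  have "?F ` (pt X ` S) \<in> IPS' \<zeta>"
  proof (rule IPS'_image[OF \<zeta> SX])
    show "continuous_on (pt X ` S) ?F"
      by (rule continuous_on_subset[OF continuous_on_transfer[OF X Y]]) (use pt_in[OF X] in blast)
    show "?F ` (pt X ` S) \<subseteq> PiE \<zeta> (\<lambda>_. UNIV)"
    proof -
      have "Y \<subseteq> PiE \<zeta> (\<lambda>_. UNIV)" using Y by (simp add: IPS_def IPS'_iff[OF \<zeta>])
      then show ?thesis using pt_in[OF Y] by blast
    qed
    show "(\<forall>i\<in>\<xi>. ?F x i = ?F y i) \<longleftrightarrow> (\<forall>i\<in>\<xi>. x i = y i)"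
      if \<xi>: "\<xi> \<in> initial_sets" "\<xi> \<subseteq> \<zeta>" and xy: "x \<in> pt X ` S" "y \<in> pt X ` S" for \<xi> x y
    proof -
      obtain a b where "x = pt X a" "y = pt X b" using xy by blast
      then show ?thesis
        using pt_agree_iff[OF X \<xi>] pt_agree_iff[OF Y \<xi>] by (simp add: inv_pt[OF X])
    qed
  qed
  then have SY: "pt Y ` S \<in> IPS' \<zeta>" by (simp add: image_image inv_pt[OF X])
  have "is_singleton (split_inf (pt Y ` S) \<Psi> a)" if \<Psi>: "admissible \<zeta> \<Psi>" for \<Psi> a
  proof -
    have range: "range \<Psi> \<subseteq> \<zeta>" using \<Psi> by (simp add: admissible_def)
    have iff: "pt X c \<in> split_inf (pt X ` S) \<Psi> a \<longleftrightarrow> pt Y c \<in> split_inf (pt Y ` S) \<Psi> a" for c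
      unfolding split_inf_def using pt_in_split_fin_iff[OF X Y SX SY range] by blast
    have sub: "split_inf Z \<Psi> a \<subseteq> Z" for Z :: "('i \<Rightarrow> cantor) set"
      using branch_0[of Z \<Psi> a] by (auto simp: split_inf_eq)
    have "is_singleton (split_inf (pt X ` S) \<Psi> a)"
      using S \<Psi> by (simp add: IPS_def shrinkable_def)
    then obtain x where x: "split_inf (pt X ` S) \<Psi> a = {x}"
      by (rule is_singletonE)
    then obtain c where c: "x = pt X c" using sub[of "pt X ` S"] by blast
    have inj: "inj (pt X)" using bij_betw_pt[OF X] by (simp add: bij_betw_def)
    have "split_inf (pt Y ` S) \<Psi> a = {pt Y c}"
    proof (intro set_eqI iffI)
      fix y assume y: "y \<in> split_inf (pt Y ` S) \<Psi> a"
      then obtain d where d: "y = pt Y d" using sub[of "pt Y ` S"] by blast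
      then have "pt X d = pt X c" using y iff x c by blast
      then show "y \<in> {pt Y c}" using d inj by (simp add: inj_eq)
    qed (use iff x c in blast)
    then show ?thesis by simp
  qed
  then show ?thesis using SY by (simp add: IPS_def shrinkable_def)
qed

lemma transfer_homeomorphism:
  assumes X: "X \<in> IPS \<zeta>" and Y: "Y \<in> IPS \<zeta>"
  defines "F \<equiv> \<lambda>x. pt Y (inv (pt X) x)"
  shows "homeomorphic_map (top_of_set X) (top_of_set Y) F"
    and "\<xi> \<in> initial_sets \<Longrightarrow> \<xi> \<subseteq> \<zeta> \<Longrightarrow> x \<in> X \<Longrightarrow> y \<in> X \<Longrightarrow>
      restrict x \<xi> = restrict y \<xi> \<longleftrightarrow> restrict (F x) \<xi> = restrict (F y) \<xi>"
    and "\<xi> \<in> initial_sets \<Longrightarrow> \<xi> \<subseteq> \<zeta> \<Longrightarrow> proj X \<xi> = proj Y \<xi> \<Longrightarrow> x \<in> X \<Longrightarrow>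
      restrict x \<xi> = restrict (F x) \<xi>"
    and "X' \<subseteq> X \<Longrightarrow> X' \<in> IPS \<zeta> \<longleftrightarrow> F ` X' \<in> IPS \<zeta>"
proof -
  show "homeomorphic_map (top_of_set X) (top_of_set Y) F"
    unfolding homeomorphic_map_maps homeomorphic_maps_def
  proof (intro exI conjI)
    show "continuous_map (top_of_set X) (top_of_set Y) F"
      unfolding F_def using continuous_on_transfer[OF X Y] pt_in[OF Y] by auto
    show "continuous_map (top_of_set Y) (top_of_set X) (\<lambda>y. pt X (inv (pt Y) y))"
      using continuous_on_transfer[OF Y X] pt_in[OF X] by auto
  qed (auto simp: F_def inv_pt[OF X] inv_pt[OF Y])
  show "restrict x \<xi> = restrict y \<xi> \<longleftrightarrow> restrict (F x) \<xi> = restrict (F y) \<xi>"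
    if "\<xi> \<in> initial_sets" "\<xi> \<subseteq> \<zeta>" "x \<in> X" "y \<in> X"
    using pt_agree_iff[OF X that(1,2), of "inv (pt X) x" "inv (pt X) y"] that(3,4)
      pt_agree_iff[OF Y that(1,2), of "inv (pt X) x" "inv (pt X) y"]
    by (simp add: restrict_eq_iff F_def inv_pt[OF X])
  show "restrict x \<xi> = restrict (F x) \<xi>"
    if "\<xi> \<in> initial_sets" "\<xi> \<subseteq> \<zeta>" "proj X \<xi> = proj Y \<xi>" "x \<in> X"
    using pt_agree[OF X Y that(1-3) refl, of "inv (pt X) x"] that(4)
    by (simp add: restrict_eq_iff F_def inv_pt[OF X])
  show "X' \<in> IPS \<zeta> \<longleftrightarrow> F ` X' \<in> IPS \<zeta>" if "X' \<subseteq> X"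
  proof -
    \<comment> \<open>\<open>X'\<close> and its image are given by one and the same set of codes, so
      the transfer applies in both directions.\<close>
    have "pt X ` (inv (pt X) ` X') = X'"
      using that inv_pt(2)[OF X] by (force simp: image_image)
    moreover have "F ` X' = pt Y ` (inv (pt X) ` X')"
      by (simp add: F_def image_image)
    ultimately show ?thesis
      using IPS_transfer[OF X Y, of "inv (pt X) ` X'"] IPS_transfer[OF Y X, of "inv (pt X) ` X'"] by auto
  qed
qed

end

text \<open>Composing an enumeration of \<open>\<zeta>\<close> with the first component of the
  decoded pair repeats each value infinitely often.\<close>

lemma admissible_exists:
  fixes \<zeta> :: "'i::{order,countable} set"
  assumes "\<zeta> \<noteq> {}"
  shows "\<exists>\<Phi>. admissible \<zeta> \<Phi>"
proof -
  obtain f :: "nat \<Rightarrow> 'i" where f: "range f = \<zeta>"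
    using uncountable_def assms by (metis countableI_type)
  define \<Phi> where "\<Phi> m = f (fst (prod_decode m))" for m
  have "infinite {m. \<Phi> m = i}" if i: "i \<in> \<zeta>" for i
  proof -
    obtain n where n: "f n = i" using f i by blast
    have "inj (\<lambda>k. prod_encode (n, k))" by (auto intro!: injI simp: prod_encode_eq)
    then have "infinite (range (\<lambda>k. prod_encode (n, k)))" by (simp add: finite_image_iff)
    moreover have "range (\<lambda>k. prod_encode (n, k)) \<subseteq> {m. \<Phi> m = i}"
      by (auto simp: \<Phi>_def n)
    ultimately show ?thesis using finite_subset by blast
  qed
  then have "admissible \<zeta> \<Phi>" using f by (auto simp: admissible_def \<Phi>_def)
  then show ?thesis by blast
qed

theorem theorem3:
  fixes \<zeta> :: "'i::{order,countable} set"
    and X Y :: "('i \<Rightarrow> cantor) set"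
  assumes "\<zeta> \<in> initial_sets"
    and "X \<in> IPS \<zeta>"
    and "Y \<in> IPS \<zeta>"
  shows "\<exists>F. homeomorphic_map (subtopology (cantor_power \<zeta>) X) (subtopology (cantor_power \<zeta>) Y) F \<and>
    (\<forall>\<xi>\<in>initial_sets. \<xi> \<subseteq> \<zeta> \<longrightarrow>
       (\<forall>x\<in>X. \<forall>y\<in>X. restrict x \<xi> = restrict y \<xi> \<longleftrightarrow> restrict (F x) \<xi> = restrict (F y) \<xi>)) \<and>
    (\<forall>\<xi>\<in>initial_sets. \<xi> \<subseteq> \<zeta> \<longrightarrow> proj X \<xi> = proj Y \<xi> \<longrightarrow>
       (\<forall>x\<in>X. restrict x \<xi> = restrict (F x) \<xi>)) \<and>
    (\<forall>X'. X' \<subseteq> X \<longrightarrow> (X' \<in> IPS \<zeta> \<longleftrightarrow> F ` X' \<in> IPS \<zeta>))"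
proof -
  have sub: "X \<subseteq> PiE \<zeta> (\<lambda>_. UNIV)" "Y \<subseteq> PiE \<zeta> (\<lambda>_. UNIV)" and ne: "X \<noteq> {}" "Y \<noteq> {}"
    using assms by (simp_all add: IPS_def IPS'_iff)
  show ?thesis
  proof (cases "\<zeta> = {}")
    case True
    \<comment> \<open>With no index there is no admissible function and hence no code, but the power
      has a single point and the identity serves as \<open>F\<close>.\<close>
    then have "X = Y" using sub ne by (simp add: subset_singleton_iff)
    then show ?thesis by (intro exI[of _ id]) auto
  next
    case False
    then obtain \<Phi> where \<Phi>: "admissible \<zeta> \<Phi>" using admissible_exists by blast
    note H = transfer_homeomorphism[OF assms(1) \<Phi> assms(2,3)]
    show ?thesis
      unfolding subtopology_cantor_power[OF sub(1)] subtopology_cantor_power[OF sub(2)]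
      by (rule exI, intro conjI ballI allI impI) (rule H; assumption)+
  qed
qed

end
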